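(* Let $0<s<1\le n$. Then, for each choice of sign $\pm$ and every $u\in\mathcal S$, $$[u]_{H^{s,1}_\pm}\ge\sup_{t\in(0,\infty)}t\,\mathrm{Cap}_{H^{s,1}_\pm}\big(\{x\in\mathbb R^n:u(x)>t\}\big)\quad\text{and}\quad[u]_{H^{s,1}_\pm}\ge\sup_{t\in(0,\infty)}t\,\mathrm{Cap}_{H^{s,1}_\pm}\big(\{x\in\mathbb R^n:u(x)<-t\}\big).$$ But if $X=H^{s,1}_+$ (with $n\ge1$ arbitrary), or $X=H^{s,1}_-$ and $n=1$, then there is no constant $C>0$ such that $$\int_0^\infty\mathrm{Cap}_X\big(\{x\in\mathbb R^n:|u(x)|>t\}\big)\,dt\le C[u]_X\qquad\forall\ u\in\mathcal S.$$
   Context: All functions are real-valued on $\mathbb R^n$; $\mathcal S$ is the Schwartz class and $\hat f(\xi)=\int f(x)e^{-2\pi ix\cdot\xi}dx$. For $u\in\mathcal S$: $\nabla^s_+u=(-\Delta)^{s/2}u$ with $((-\Delta)^{s/2}u)^\wedge(\xi)=(2\pi|\xi|)^s\hat u(\xi)$, and $\nabla^s_-u=(\nabla^s_1u,\dots,\nabla^s_nu)$ with $(\nabla^s_ju)^\wedge(\xi)=(-2\pi i\xi_j)(2\pi|\xi|)^{s-1}\hat u(\xi)$. $[u]_{H^{s,1}_+}=\|\nabla^s_+u\|_{L^1}$ and $[u]_{H^{s,1}_-}=\sum_{j=1}^n\|\nabla^s_ju\|_{L^1}$. For $X\in\{H^{s,1}_+,H^{s,1}_-\}$ and compact $K$,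 $\mathrm{Cap}_X(K)=\inf\{[u]_X:u\in\mathcal S,\ u\ge1\text{ on }K\}$; for open $O$, $\mathrm{Cap}_X(O)=\sup\{\mathrm{Cap}_X(K):K\subset O\text{ compact}\}$. *)

theory Defs
  imports "HOL-Analysis.Analysis"
begin

definition partial :: "'n::finite \<Rightarrow> (real^'n \<Rightarrow> real) \<Rightarrow> real^'n \<Rightarrow> real" where
  "partial j f = (\<lambda>x. frechet_derivative f (at x) (axis j 1))"

(* A list of coordinate indices stands for a multi-index; the order of the
   entries is irrelevant for smooth functions. *)
primrec iterated_partial :: "'n::finite list \<Rightarrow> (real^'n \<Rightarrow> real) \<Rightarrow> real^'n \<Rightarrow> real" where
  "iterated_partial [] f = f"
| "iterated_partial (j # js) f = partial j (iterated_partial js f)"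

definition schwartz :: "(real^'n::finite \<Rightarrow> real) set" where
  "schwartz = {u. \<forall>js. (\<forall>x. iterated_partial js u differentiable (at x)) \<and>
     (\<forall>k::nat. bounded (range (\<lambda>x. norm x ^ k * iterated_partial js u x)))}"

definition fourier :: "(real^'n::finite \<Rightarrow> complex) \<Rightarrow> real^'n \<Rightarrow> complex" where
  "fourier f \<xi> = (LINT x|lborel. f x * exp (- (2 * of_real pi * \<i> * of_real (x \<bullet> \<xi>))))"

definition inverse_fourier :: "(real^'n::finite \<Rightarrow> complex) \<Rightarrow> real^'n \<Rightarrow> complex" where
  "inverse_fourier g x = (LINT \<xi>|lborel. g \<xi> * exp (2 * of_real pi * \<i> * of_real (x \<bullet> \<xi>)))"

(* The function whose Fourier transform is m times the transform of u.  For
   Schwartz u and the multipliers below (s > 0), m times the transform of u is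
   absolutely integrable, so the inversion integral converges at every point.
   Those multipliers satisfy m (- \<xi>) = cnj (m \<xi>), so for real-valued u the
   result is real-valued, although its type is complex. *)
definition fourier_multiplier ::
    "(real^'n::finite \<Rightarrow> complex) \<Rightarrow> (real^'n \<Rightarrow> real) \<Rightarrow> real^'n \<Rightarrow> complex" where
  "fourier_multiplier m u =
     inverse_fourier (\<lambda>\<xi>. m \<xi> * fourier (\<lambda>x. of_real (u x)) \<xi>)"

definition nabla_plus :: "real \<Rightarrow> (real^'n::finite \<Rightarrow> real) \<Rightarrow> real^'n \<Rightarrow> complex" where
  "nabla_plus s = fourier_multiplier (\<lambda>\<xi>. of_real ((2 * pi * norm \<xi>) powr s))"

(* At \<xi> = 0 the factor \<xi> $ j makes the multiplier vanish, which is its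
   continuous extension for s > 0. *)
definition nabla_minus :: "real \<Rightarrow> 'n \<Rightarrow> (real^'n::finite \<Rightarrow> real) \<Rightarrow> real^'n \<Rightarrow> complex" where
  "nabla_minus s j = fourier_multiplier
     (\<lambda>\<xi>. - (2 * of_real pi * \<i> * of_real (\<xi> $ j)) * of_real ((2 * pi * norm \<xi>) powr (s - 1)))"

definition L1_norm :: "(real^'n::finite \<Rightarrow> complex) \<Rightarrow> ennreal" where
  "L1_norm f = (\<integral>\<^sup>+x. ennreal (norm (f x)) \<partial>lborel)"

definition H_plus :: "real \<Rightarrow> (real^'n::finite \<Rightarrow> real) \<Rightarrow> ennreal" where
  "H_plus s u = L1_norm (nabla_plus s u)"

definition H_minus :: "real \<Rightarrow> (real^'n::finite \<Rightarrow> real) \<Rightarrow> ennreal" where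
  "H_minus s u = (\<Sum>j\<in>UNIV. L1_norm (nabla_minus s j u))"

definition cap_compact ::
    "((real^'n::finite \<Rightarrow> real) \<Rightarrow> ennreal) \<Rightarrow> (real^'n) set \<Rightarrow> ennreal" where
  "cap_compact X K = (INF u \<in> {u \<in> schwartz. \<forall>x\<in>K. u x \<ge> 1}. X u)"

definition cap_open ::
    "((real^'n::finite \<Rightarrow> real) \<Rightarrow> ennreal) \<Rightarrow> (real^'n) set \<Rightarrow> ennreal" where
  "cap_open X U = (SUP K \<in> {K. compact K \<and> K \<subseteq> U}. cap_compact X K)"

end

theory Submission
  imports Defs "HOL-Probability.Characteristic_Functions" "HOL-Probability.Sinc_Integral"
begin

text \<open>The weak-type bounds hold because \<open>u / t\<close> and \<open>- u / t\<close> are admissible for the level sets.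

  The strong-type bound fails because of a logarithm. Testing against the potential of a product of
  tents, which is bounded since its transform is integrable, shows that a cube of side \<open>r\<close> has capacity
  at least a constant times \<open>r powr (n - s)\<close>. On the other hand let \<open>u\<close> be the fundamental solution
  \<open>norm x powr (s - n)\<close> (respectively \<open>x * \<bar>x\<bar> powr (s - 2)\<close> for \<open>n = 1\<close> and the minus sign), written as
  an integral of Gaussians over the width \<open>\<tau>\<close> and truncated to \<open>A \<le> \<tau> \<le> 1\<close>. Its fractional derivative is
  the difference of two dilates of one superposition of Gaussians of finite mass, so its \<open>L1\<close> norm is
  bounded independently of \<open>A\<close>, whereas the integral of the capacities of the level sets dominates the
  integral of \<open>1 / t\<close> over a range whose logarithmic length tends to infinity as \<open>A\<close> tends to 0.\<close>

section \<open>The Fourier transform on integrable functions\<close>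

text \<open>The logarithm comes from matching exponents. Pairing a competitor for a cube of side
  comparable to r with a tent product supported there gives at least r^n up to a constant, while the
  potential of that tent product is at most a constant times r^s; hence the capacity r^(n-s). The
  test function has height comparable to r^(s-n) on such a cube, so height times capacity does not
  depend on r and every scale contributes equally to the integral over t. The obstacle is that the
  operators are nonlocal: cutting the fundamental solution off in space would leave error terms to
  be estimated in L1. Cutting off in \<tau> stays explicit on the Fourier side, and as A tends to 0
  the fractional derivative is an approximate point mass minus a fixed function, so that only masses
  have to be counted. For the minus sign, n = 1 makes the modulus of the symbol equal to
  \<open>(2 * pi * norm \<xi>) powr s\<close>, so the division by the symbol in the lower bound
  works as for the plus sign; for n > 1 each component of the symbol vanishes on a
  hyperplane.\<close>

lemma fourier_eq_cis:
  "fourier f \<xi> = (LINT x|lborel. f x * cis (- (2 * pi * (x \<bullet> \<xi>))))"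
  unfolding fourier_def by (simp add: cis_conv_exp mult_ac)

lemma inverse_fourier_eq: "inverse_fourier g x = fourier g (- x)"
  unfolding inverse_fourier_def fourier_def by (simp add: inner_commute)

lemma borel_measurable_cis [measurable (raw)]:
  "g \<in> borel_measurable M \<Longrightarrow> (\<lambda>x. cis (g x)) \<in> borel_measurable M"
  unfolding cis_conv_exp by measurable

lemma integrable_cis_iff:
  fixes f :: "'a::euclidean_space \<Rightarrow> complex"
  assumes [measurable]: "g \<in> borel_measurable borel"
  shows "integrable lborel (\<lambda>x. f x * cis (g x)) \<longleftrightarrow> integrable lborel f"
proof
  show "integrable lborel f" if "integrable lborel (\<lambda>x. f x * cis (g x))"
  proof (rule Bochner_Integration.integrable_bound[OF that])
    have "(\<lambda>x. (f x * cis (g x)) * cis (- g x)) \<in> borel_measurable lborel"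
      using that by measurable
    then show "f \<in> borel_measurable lborel"
      by (simp add: mult.assoc cis_mult)
  qed (simp add: norm_mult)
  show "integrable lborel (\<lambda>x. f x * cis (g x))" if "integrable lborel f"
    by (rule Bochner_Integration.integrable_bound[OF that]) (use that in \<open>auto simp: norm_mult\<close>)
qed

lemma norm_fourier_le: "norm (fourier f \<xi>) \<le> (LINT x|lborel. norm (f x))"
  unfolding fourier_eq_cis
  by (rule order_trans[OF integral_norm_bound]) (simp add: norm_mult)

lemma continuous_on_fourier:
  fixes f :: "real^'n::finite \<Rightarrow> complex"
  assumes f: "integrable lborel f"
  shows "continuous_on UNIV (fourier f)"
proof -
  have [measurable]: "f \<in> borel_measurable borel" using f by auto
  show ?thesis
    unfolding continuous_on_sequentially comp_def fourier_eq_cis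
  proof safe
    fix X :: "nat \<Rightarrow> real^'n" and a assume X: "X \<longlonglongrightarrow> a"
    show "(\<lambda>n. LINT x|lborel. f x * cis (- (2 * pi * (x \<bullet> X n)))) \<longlonglongrightarrow>
      (LINT x|lborel. f x * cis (- (2 * pi * (x \<bullet> a))))"
    proof (rule integral_dominated_convergence[where w = "\<lambda>x. norm (f x)"])
      show "AE x in lborel. (\<lambda>n. f x * cis (- (2 * pi * (x \<bullet> X n)))) \<longlonglongrightarrow> f x * cis (- (2 * pi * (x \<bullet> a)))"
        unfolding cis_conv_exp by (intro AE_I2 tendsto_intros X)
    qed (use f in \<open>auto simp: norm_mult\<close>)
  qed
qed

lemma borel_measurable_fourier [measurable]:
  fixes f :: "real^'n::finite \<Rightarrow> complex"
  assumes [measurable]: "f \<in> borel_measurable borel"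
  shows "fourier f \<in> borel_measurable borel"
  unfolding fourier_eq_cis[abs_def] by measurable

text \<open>Tonelli turns the bound by a product of one-variable functions into a product of two
  finite integrals. Every later use of \<open>Fubini_integral\<close> rests on this
  criterion.\<close>

lemma integrable_lborel_pairI:
  fixes h :: "'a::euclidean_space \<times> 'b::euclidean_space \<Rightarrow> 'c::{banach, second_countable_topology}"
    and f :: "'a \<Rightarrow> 'd::{banach, second_countable_topology}"
    and g :: "'b \<Rightarrow> 'e::{banach, second_countable_topology}"
  assumes [measurable]: "h \<in> borel_measurable (lborel \<Otimes>\<^sub>M lborel)"
    and f: "integrable lborel f" and g: "integrable lborel g"
    and le: "\<And>x y. norm (h (x, y)) \<le> norm (f x) * norm (g y)"
  shows "integrable (lborel \<Otimes>\<^sub>M lborel) h"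
proof (rule integrableI_bounded)
  have [measurable]: "f \<in> borel_measurable borel" "g \<in> borel_measurable borel" using f g by auto
  have "(\<integral>\<^sup>+ z. norm (h z) \<partial>(lborel \<Otimes>\<^sub>M lborel)) = (\<integral>\<^sup>+ x. \<integral>\<^sup>+ y. norm (h (x, y)) \<partial>lborel \<partial>lborel)"
    by (subst lborel.nn_integral_fst[symmetric]) auto
  also have "\<dots> \<le> (\<integral>\<^sup>+ x. \<integral>\<^sup>+ y. ennreal (norm (f x)) * ennreal (norm (g y)) \<partial>lborel \<partial>lborel)"
    by (intro nn_integral_mono) (auto simp: ennreal_mult'[symmetric] le)
  also have "\<dots> = (\<integral>\<^sup>+ x. norm (f x) \<partial>lborel) * (\<integral>\<^sup>+ y. norm (g y) \<partial>lborel)"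
    by (simp add: nn_integral_cmult nn_integral_multc)
  also have "\<dots> < \<infinity>"
    using f[unfolded integrable_iff_bounded, THEN conjunct2] g[unfolded integrable_iff_bounded, THEN conjunct2]
    by (simp only: ennreal_mult_less_top infinity_ennreal_def) blast
  finally show "(\<integral>\<^sup>+ z. norm (h z) \<partial>(lborel \<Otimes>\<^sub>M lborel)) < \<infinity>" .
qed simp

text \<open>Both sides are iterated integrals of one kernel. The formula drives the inversion
  theorem as well as the duality behind the capacity estimate.\<close>

lemma fourier_multiplication_formula:
  fixes f g :: "real^'n::finite \<Rightarrow> complex"
  assumes f: "integrable lborel f" and g: "integrable lborel g"
  shows "(LINT x|lborel. f x * fourier g x) = (LINT x|lborel. fourier f x * g x)"
proof -
  have [measurable]: "f \<in> borel_measurable borel" "g \<in> borel_measurable borel" using f g by auto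
  define h where "h x y = f x * g y * cis (- (2 * pi * (x \<bullet> y)))" for x y
  have "case_prod h \<in> borel_measurable (lborel \<Otimes>\<^sub>M lborel)"
    unfolding h_def by measurable
  then have int: "integrable (lborel \<Otimes>\<^sub>M lborel) (case_prod h)"
    by (rule integrable_lborel_pairI[OF _ f g]) (auto simp: h_def norm_mult)
  have "(LINT x|lborel. f x * fourier g x) = (LINT x|lborel. LINT y|lborel. h x y)"
    unfolding fourier_eq_cis h_def integral_mult_right_zero[symmetric]
    by (intro Bochner_Integration.integral_cong refl) (simp add: inner_commute mult_ac)
  also have "\<dots> = (LINT y|lborel. LINT x|lborel. h x y)"
    by (rule lborel_pair.Fubini_integral[OF int, symmetric])
  also have "\<dots> = (LINT y|lborel. fourier f y * g y)"
    unfolding fourier_eq_cis h_def integral_mult_left_zero[symmetric]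
    by (intro Bochner_Integration.integral_cong refl) (simp add: inner_commute mult_ac)
  finally show ?thesis .
qed

section \<open>Functions that are products over the coordinates\<close>

lemma
  fixes f :: "'n::finite \<Rightarrow> real \<Rightarrow> 'a::{real_normed_field, banach, second_countable_topology}"
  assumes f: "\<And>i. integrable lborel (f i)"
  shows integrable_prod_vec: "integrable lborel (\<lambda>x::real^'n. \<Prod>i\<in>UNIV. f i (x $ i))" (is ?A)
    and integral_prod_vec: "integral\<^sup>L lborel (\<lambda>x::real^'n. \<Prod>i\<in>UNIV. f i (x $ i)) = (\<Prod>i\<in>UNIV. LINT t|lborel. f i t)" (is ?B)
proof -
  interpret product_sigma_finite "\<lambda>_::real^'n. lborel :: real measure" ..
  have [measurable]: "\<And>i. f i \<in> borel_measurable borel" using f by auto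
  \<comment> \<open>\<open>lborel\<close> is the image of a product measure indexed by
    \<open>Basis\<close>, whereas \<open>f\<close> is indexed by coordinates; \<open>ix\<close>
    reads the coordinate off a basis vector.\<close>
  define ix :: "real^'n \<Rightarrow> 'n" where "ix b = (THE i. b = axis i 1)" for b
  have ix: "ix (axis i 1) = i" for i
    unfolding ix_def by (auto simp: axis_eq_axis)
  have Basis: "Basis = range (\<lambda>i. axis i 1 :: real^'n)"
    by (auto simp: Basis_vec_def)
  have inj: "inj (\<lambda>i. axis i 1 :: real^'n)"
    by (auto simp: inj_on_def axis_eq_axis)
  have comp: "(\<Sum>b\<in>Basis. y b *\<^sub>R b) $ i = y (axis i 1)" for y :: "real^'n \<Rightarrow> real" and i
  proof -
    have "(\<Sum>b\<in>Basis. y b *\<^sub>R b) $ i = (\<Sum>b\<in>Basis. y b *\<^sub>R b) \<bullet> axis i 1"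
      by (simp add: inner_axis)
    also have "\<dots> = y (axis i 1)" by (rule inner_sum_left_Basis) (auto simp: Basis)
    finally show ?thesis .
  qed
  have eq: "(\<Prod>i\<in>UNIV. f i ((\<Sum>b\<in>Basis. y b *\<^sub>R b) $ i)) = (\<Prod>b\<in>Basis. f (ix b) (y b))"
    for y :: "real^'n \<Rightarrow> real"
    unfolding comp unfolding Basis by (subst prod.reindex[OF inj]) (simp add: ix)
  have "integrable (Pi\<^sub>M Basis (\<lambda>_::real^'n. lborel)) (\<lambda>y. \<Prod>b\<in>Basis. f (ix b) (y b))"
    by (rule product_integrable_prod) (auto intro: f)
  then show ?A
    by (subst lborel_eq, subst integrable_distr_eq) (simp_all add: eq del: sum_component)
  have "integral\<^sup>L lborel (\<lambda>x::real^'n. \<Prod>i\<in>UNIV. f i (x $ i)) =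
     (LINT y|Pi\<^sub>M Basis (\<lambda>_::real^'n. lborel). (\<Prod>b\<in>Basis. f (ix b) (y b)))"
    by (subst lborel_eq, subst integral_distr) (simp_all add: eq del: sum_component)
  also have "\<dots> = (\<Prod>b\<in>(Basis :: (real^'n) set). LINT t|lborel. f (ix b) t)"
    by (rule product_integral_prod) (auto intro: f)
  also have "\<dots> = (\<Prod>i\<in>UNIV. LINT t|lborel. f i t)"
    unfolding Basis by (subst prod.reindex[OF inj]) (simp add: ix)
  finally show ?B .
qed

lemma cis_inner_eq_prod:
  fixes x y :: "real^'n::finite"
  shows "cis (- (2 * pi * (x \<bullet> y))) = (\<Prod>i\<in>UNIV. cis (- (2 * pi * (x $ i * y $ i))))"
proof -
  have "(\<Prod>i\<in>I. cis (- (2 * pi * (x $ i * y $ i)))) = cis (\<Sum>i\<in>I. - (2 * pi * (x $ i * y $ i)))"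
    if "finite I" for I
    using that by (induction I) (auto simp: cis_mult)
  from this[of UNIV] show ?thesis
    by (simp add: inner_vec_def sum_distrib_left sum_negf)
qed

lemma fourier_prod_vec:
  fixes f :: "'n::finite \<Rightarrow> real \<Rightarrow> complex"
  assumes f: "\<And>i. integrable lborel (f i)"
  shows "fourier (\<lambda>x::real^'n. \<Prod>i\<in>UNIV. f i (x $ i)) \<xi> =
    (\<Prod>i\<in>UNIV. LINT t|lborel. f i t * cis (- (2 * pi * (t * \<xi> $ i))))"
  unfolding fourier_eq_cis cis_inner_eq_prod prod.distrib[symmetric]
  by (rule integral_prod_vec) (intro integrable_cis_iff[THEN iffD2] f, measurable)

section \<open>Gaussians and Fourier inversion\<close>

text \<open>The transform is the characteristic function of the standard normal distribution after
  the substitution \<open>c * x\<close>.\<close>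

lemma
  assumes \<tau>: "0 < \<tau>"
  shows integrable_gaussian: "integrable lborel (\<lambda>x::real. exp (- (pi * x\<^sup>2 / \<tau>)))" (is ?A)
    and fourier_gaussian_real: "(LINT x|lborel. complex_of_real (exp (- (pi * x\<^sup>2 / \<tau>))) * cis (- (2 * pi * (x * \<xi>)))) =
      of_real (sqrt \<tau> * exp (- (pi * \<tau> * \<xi>\<^sup>2)))" (is ?B)
proof -
  define c where "c = sqrt (2 * pi / \<tau>)"
  have c: "c > 0" "c\<^sup>2 = 2 * pi / \<tau>" using \<tau> by (auto simp: c_def)
  have e: "(c * x)\<^sup>2 / 2 = pi * x\<^sup>2 / \<tau>" for x using c(2) by (simp add: power_mult_distrib)
  have "integrable lborel (\<lambda>x. std_normal_density (0 + c * x))"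
    using c by (intro lborel_integrable_real_affine integrable_normal_density) auto
  then have "integrable lborel (\<lambda>x. sqrt (2 * pi) * std_normal_density (0 + c * x))" by simp
  then show ?A
    by (simp add: std_normal_density_def e)
  \<comment> \<open>The argument at which the characteristic function is read: \<open>t * c\<close>
    has to be the frequency \<open>- (2 * pi * \<xi>)\<close>.\<close>
  define t where "t = - \<xi> * sqrt (2 * pi * \<tau>)"
  have tc: "t * c = - (2 * pi * \<xi>)"
    using \<tau> by (simp add: t_def c_def real_sqrt_mult real_sqrt_divide field_simps)
  have t2: "t\<^sup>2 / 2 = pi * \<tau> * \<xi>\<^sup>2"
    using \<tau> by (simp add: t_def power_mult_distrib)
  have "complex_of_real (exp (- t\<^sup>2 / 2)) = (LINT x|lborel. std_normal_density x *\<^sub>R cis (t * x))"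
    using char_std_normal_distribution[THEN fun_cong, of t]
    unfolding char_def by (subst (asm) integral_density) (auto simp: cis_conv_exp)
  also have "\<dots> = c *\<^sub>R (LINT x|lborel. std_normal_density (0 + c * x) *\<^sub>R cis (t * (0 + c * x)))"
    using c by (subst lborel_integral_real_affine[of c _ 0]) auto
  also have "\<dots> = (c / sqrt (2 * pi)) *\<^sub>R (LINT x|lborel. complex_of_real (exp (- (pi * x\<^sup>2 / \<tau>))) * cis (- (2 * pi * (x * \<xi>))))"
  proof -
    have "std_normal_density (0 + c * x) *\<^sub>R cis (t * (0 + c * x)) =
      (1 / sqrt (2 * pi)) *\<^sub>R (complex_of_real (exp (- (pi * x\<^sup>2 / \<tau>))) * cis (- (2 * pi * (x * \<xi>))))" for x
    proof -
      have "t * (0 + c * x) = - (2 * pi * (x * \<xi>))" using tc by (simp add: mult.assoc[symmetric])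
      then show ?thesis by (simp add: std_normal_density_def e scaleR_conv_of_real)
    qed
    then show ?thesis by simp
  qed
  also have "c / sqrt (2 * pi) = 1 / sqrt \<tau>"
    using \<tau> by (simp add: c_def real_sqrt_divide)
  finally have *: "complex_of_real (exp (- t\<^sup>2 / 2)) =
     (1 / sqrt \<tau>) *\<^sub>R (LINT x|lborel. complex_of_real (exp (- (pi * x\<^sup>2 / \<tau>))) * cis (- (2 * pi * (x * \<xi>))))" .
  have "of_real (sqrt \<tau> * exp (- (pi * \<tau> * \<xi>\<^sup>2))) = sqrt \<tau> *\<^sub>R complex_of_real (exp (- t\<^sup>2 / 2))"
    using t2 by (simp add: scaleR_conv_of_real)
  then show ?B unfolding * using \<tau> by simp
qed

text \<open>Normalised to height 1 rather than mass 1, with \<tau> on the scale of a squared length.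
  The mass is \<tau> to the power n/2, and the transform is a multiple of
  \<open>gauss (1 / \<tau>)\<close>.\<close>

definition gauss :: "real \<Rightarrow> real^'n::finite \<Rightarrow> real" where
  "gauss \<tau> x = exp (- (pi * (norm x)\<^sup>2 / \<tau>))"

lemma norm_vec_power2: "(norm (x::real^'n::finite))\<^sup>2 = (\<Sum>i\<in>UNIV. (x $ i)\<^sup>2)"
  unfolding power2_norm_eq_inner inner_vec_def by (simp add: power2_eq_square)

lemma gauss_eq_prod: "gauss \<tau> (x::real^'n::finite) = (\<Prod>i\<in>UNIV. exp (- (pi * (x $ i)\<^sup>2 / \<tau>)))"
  unfolding gauss_def norm_vec_power2
  by (simp add: exp_sum[symmetric] sum_negf sum_divide_distrib sum_distrib_left)

lemma borel_measurable_gauss [measurable]: "gauss \<tau> \<in> borel_measurable borel"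
  unfolding gauss_def[abs_def] by measurable

lemma gauss_pos: "0 < gauss \<tau> x"
  by (simp add: gauss_def)

lemma gauss_le_1: "0 < \<tau> \<Longrightarrow> gauss \<tau> x \<le> 1"
  by (simp add: gauss_def)

lemma integrable_gauss: "0 < \<tau> \<Longrightarrow> integrable lborel (gauss \<tau> :: real^'n::finite \<Rightarrow> real)"
  unfolding gauss_eq_prod[abs_def] by (intro integrable_prod_vec integrable_gaussian)

lemma fourier_gauss:
  assumes "0 < \<tau>"
  shows "fourier (\<lambda>x. of_real (gauss \<tau> x)) (\<xi>::real^'n::finite) =
    of_real (\<tau> powr (real CARD('n) / 2) * gauss (1 / \<tau>) \<xi>)"
proof -
  have "fourier (\<lambda>x. of_real (gauss \<tau> x)) \<xi> =
    (\<Prod>i\<in>UNIV. of_real (sqrt \<tau> * exp (- (pi * \<tau> * (\<xi> $ i)\<^sup>2))))"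
    unfolding gauss_eq_prod of_real_prod using assms
    by (subst fourier_prod_vec) (auto simp: fourier_gaussian_real integrable_gaussian simp del: of_real_mult)
  also have "\<dots> = of_real (sqrt \<tau> ^ CARD('n) * gauss (1 / \<tau>) \<xi>)"
    unfolding gauss_eq_prod of_real_prod[symmetric] by (simp add: prod.distrib mult_ac)
  also have "sqrt \<tau> ^ CARD('n) = \<tau> powr (real CARD('n) / 2)"
    using assms by (simp add: powr_half_sqrt[symmetric] powr_realpow[symmetric] powr_powr)
  finally show ?thesis .
qed

lemma integral_gauss:
  assumes "0 < \<tau>"
  shows "(LINT x|lborel. gauss \<tau> (x::real^'n::finite)) = \<tau> powr (real CARD('n) / 2)"
proof -
  have "complex_of_real (LINT x|lborel. gauss \<tau> (x::real^'n)) = fourier (\<lambda>x. of_real (gauss \<tau> x)) (0::real^'n)"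
    unfolding fourier_eq_cis by simp
  also have "\<dots> = of_real (\<tau> powr (real CARD('n) / 2))"
    using assms by (simp add: fourier_gauss) (simp add: gauss_def)
  finally show ?thesis by (simp only: of_real_eq_iff)
qed

lemma lborel_integral_affine:
  fixes f :: "'a::euclidean_space \<Rightarrow> 'b::{banach, second_countable_topology}"
  assumes [measurable]: "f \<in> borel_measurable borel" and "c \<noteq> 0"
  shows "(LINT x|lborel. f x) = \<bar>c\<bar> ^ DIM('a) *\<^sub>R (LINT x|lborel. f (t + c *\<^sub>R x))"
  by (subst lborel_affine[OF \<open>c \<noteq> 0\<close>, of t]) (simp add: integral_density integral_distr)

text \<open>Damping \<open>fourier g\<close> by \<open>gauss \<tau>\<close>, the multiplication formula turns the double transform
  into convolution of \<open>g\<close> with an approximate identity; then \<open>\<tau>\<close> tends to infinity.\<close>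

lemma fourier_fourier:
  fixes g :: "real^'n::finite \<Rightarrow> complex"
  assumes g: "integrable lborel g" and cont: "continuous_on UNIV g" and bdd: "\<And>x. norm (g x) \<le> B"
    and Fg: "integrable lborel (fourier g)"
  shows "fourier (fourier g) \<eta> = g (- \<eta>)"
proof -
  have [measurable]: "g \<in> borel_measurable borel" using g by auto
  have [measurable]: "fourier g \<in> borel_measurable borel" using Fg by auto
  let ?N = "real CARD('n)"
  define \<tau> where "\<tau> k = real (Suc k)" for k
  have \<tau>: "\<tau> k > 0" for k by (simp add: \<tau>_def)
  have \<tau>_inf: "filterlim \<tau> at_top sequentially"
    unfolding \<tau>_def by (rule filterlim_compose[OF filterlim_real_sequentially filterlim_Suc])
  \<comment> \<open>The character moves the centre of the transformed Gaussian to
    \<open>- \<eta>\<close>, the point at which \<open>g\<close> is to be recovered.\<close>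
  define \<gamma> where "\<gamma> k x = of_real (gauss (\<tau> k) x) * cis (- (2 * pi * (x \<bullet> \<eta>)))" for k x
  have \<gamma>: "integrable lborel (\<gamma> k)" for k
    unfolding \<gamma>_def by (intro integrable_cis_iff[THEN iffD2]) (auto simp: integrable_gauss \<tau>)
  have F\<gamma>: "fourier (\<gamma> k) y = of_real (\<tau> k powr (?N / 2) * gauss (1 / \<tau> k) (y + \<eta>))" for k y
  proof -
    have "fourier (\<gamma> k) y = fourier (\<lambda>x. of_real (gauss (\<tau> k) x)) (y + \<eta>)"
      unfolding fourier_eq_cis \<gamma>_def
      by (simp add: mult.assoc cis_mult inner_add_right algebra_simps)
    then show ?thesis by (simp add: fourier_gauss \<tau>)
  qed
  have "(\<lambda>k. LINT x|lborel. fourier g x * \<gamma> k x) \<longlonglongrightarrow> (LINT x|lborel. fourier g x * cis (- (2 * pi * (x \<bullet> \<eta>))))"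
  proof (rule integral_dominated_convergence[where w = "\<lambda>x. norm (fourier g x)"])
    show "AE x in lborel. (\<lambda>k. fourier g x * \<gamma> k x) \<longlonglongrightarrow> fourier g x * cis (- (2 * pi * (x \<bullet> \<eta>)))"
    proof (rule AE_I2)
      fix x :: "real^'n"
      have "(\<lambda>k. pi * (norm x)\<^sup>2 / \<tau> k) \<longlonglongrightarrow> 0"
        by (rule real_tendsto_divide_at_top[OF tendsto_const \<tau>_inf])
      then have "(\<lambda>k. gauss (\<tau> k) x) \<longlonglongrightarrow> exp (- 0)"
        unfolding gauss_def by (intro tendsto_intros)
      then have "(\<lambda>k. fourier g x * (of_real (gauss (\<tau> k) x) * cis (- (2 * pi * (x \<bullet> \<eta>))))) \<longlonglongrightarrow>
          fourier g x * (of_real (exp (- 0)) * cis (- (2 * pi * (x \<bullet> \<eta>))))"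
        by (intro tendsto_intros)
      then show "(\<lambda>k. fourier g x * \<gamma> k x) \<longlonglongrightarrow> fourier g x * cis (- (2 * pi * (x \<bullet> \<eta>)))"
        by (simp add: \<gamma>_def)
    qed
    show "AE x in lborel. norm (fourier g x * \<gamma> k x) \<le> norm (fourier g x)" for k
            by (intro AE_I2) (auto simp: \<gamma>_def norm_mult abs_of_pos gauss_pos intro!: mult_left_le gauss_le_1 \<tau>)
  qed (use Fg in \<open>auto simp: \<gamma>_def\<close>)
  also have "(\<lambda>k. LINT x|lborel. fourier g x * \<gamma> k x) = (\<lambda>k. LINT z|lborel. g (- \<eta> + (1 / sqrt (\<tau> k)) *\<^sub>R z) * of_real (gauss 1 z))"
  proof
    fix k
    \<comment> \<open>The substitution \<open>- \<eta> + (1 / sqrt (\<tau> k)) *\<^sub>R z\<close>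
      freezes the concentrating Gaussian; its Jacobian cancels
      \<open>\<tau> k powr (?N / 2)\<close>, and the dependence on \<open>k\<close> is left in the
      argument of \<open>g\<close> alone.\<close>
    have rescale: "gauss (1 / \<tau> k) ((- \<eta> + (1 / sqrt (\<tau> k)) *\<^sub>R z) + \<eta>) = gauss 1 z" for z
      using \<tau>[of k] by (simp add: gauss_def power_divide)
    have "(LINT x|lborel. fourier g x * \<gamma> k x) = (LINT y|lborel. g y * fourier (\<gamma> k) y)"
      by (rule fourier_multiplication_formula[OF g \<gamma>, symmetric])
    also have "\<dots> = (LINT y|lborel. \<tau> k powr (?N / 2) *\<^sub>R (g y * of_real (gauss (1 / \<tau> k) (y + \<eta>))))"
      unfolding F\<gamma> by (simp add: scaleR_conv_of_real mult_ac)
    also have "\<dots> = \<bar>1 / sqrt (\<tau> k)\<bar> ^ DIM(real^'n) *\<^sub>R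
       (LINT z|lborel. \<tau> k powr (?N / 2) *\<^sub>R (g (- \<eta> + (1 / sqrt (\<tau> k)) *\<^sub>R z) * of_real (gauss (1 / \<tau> k) ((- \<eta> + (1 / sqrt (\<tau> k)) *\<^sub>R z) + \<eta>))))"
      using \<tau>[of k] by (intro lborel_integral_affine) auto
    also have "\<bar>1 / sqrt (\<tau> k)\<bar> ^ DIM(real^'n) = 1 / \<tau> k powr (?N / 2)"
      using \<tau>[of k] by (simp add: powr_half_sqrt[symmetric] powr_realpow[symmetric] powr_powr power_divide)
    finally show "(LINT x|lborel. fourier g x * \<gamma> k x) = (LINT z|lborel. g (- \<eta> + (1 / sqrt (\<tau> k)) *\<^sub>R z) * of_real (gauss 1 z))"
      using \<tau>[of k] unfolding rescale by simp
  qed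
  finally have lim1: "(\<lambda>k. LINT z|lborel. g (- \<eta> + (1 / sqrt (\<tau> k)) *\<^sub>R z) * of_real (gauss 1 z)) \<longlonglongrightarrow> fourier (fourier g) \<eta>"
    unfolding fourier_eq_cis[of "fourier g"] .
  have "(\<lambda>k. LINT z|lborel. g (- \<eta> + (1 / sqrt (\<tau> k)) *\<^sub>R z) * of_real (gauss 1 z)) \<longlonglongrightarrow>
    (LINT z|lborel. g (- \<eta>) * of_real (gauss 1 (z::real^'n)))"
  proof (rule integral_dominated_convergence[where w = "\<lambda>z. B * gauss 1 z"])
    show "integrable lborel (\<lambda>z::real^'n. B * gauss 1 z)"
      by (simp add: integrable_gauss)
    have "(\<lambda>k. 1 / sqrt (\<tau> k)) \<longlonglongrightarrow> 0"
      by (rule real_tendsto_divide_at_top[OF tendsto_const filterlim_compose[OF sqrt_at_top \<tau>_inf]])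
    then have "(\<lambda>k. - \<eta> + (1 / sqrt (\<tau> k)) *\<^sub>R z) \<longlonglongrightarrow> - \<eta> + 0 *\<^sub>R z" for z
      by (intro tendsto_intros)
    then have "(\<lambda>k. g (- \<eta> + (1 / sqrt (\<tau> k)) *\<^sub>R z)) \<longlonglongrightarrow> g (- \<eta>)" for z
      using cont by (intro continuous_on_tendsto_compose[OF cont]) auto
    then show "AE z in lborel. (\<lambda>k. g (- \<eta> + (1 / sqrt (\<tau> k)) *\<^sub>R z) * of_real (gauss 1 z)) \<longlonglongrightarrow> g (- \<eta>) * of_real (gauss 1 z)"
      by (intro AE_I2 tendsto_intros)
    show "AE z in lborel. norm (g (- \<eta> + (1 / sqrt (\<tau> k)) *\<^sub>R z) * of_real (gauss 1 z)) \<le> B * gauss 1 z" for k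
      by (intro AE_I2) (auto simp: norm_mult abs_of_pos gauss_pos less_imp_le[OF gauss_pos] intro!: mult_right_mono bdd)
  qed auto
  also have "(LINT z|lborel. g (- \<eta>) * of_real (gauss 1 (z::real^'n))) = g (- \<eta>)"
    by (simp add: integral_gauss)
  finally show ?thesis using LIMSEQ_unique[OF lim1] by simp
qed

section \<open>Schwartz functions\<close>

text \<open>A product over the coordinates rather than a function of the norm, so that integrability
  reduces to one variable by \<open>integrable_prod_vec\<close>.\<close>

definition cauchy_weight :: "real^'n::finite \<Rightarrow> real" where
  "cauchy_weight x = (\<Prod>i\<in>UNIV. inverse (1 + (x $ i)\<^sup>2))"

lemma cauchy_weight_pos: "0 < cauchy_weight x"
  unfolding cauchy_weight_def by (intro prod_pos) (simp add: add_pos_nonneg)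

lemma integrable_inverse_1_plus_square_real: "integrable lborel (\<lambda>x::real. inverse (1 + x\<^sup>2))"
  using integrable_inverse_1_plus_square by (simp add: set_integrable_def)

lemma integrable_cauchy_weight: "integrable lborel (cauchy_weight :: real^'n::finite \<Rightarrow> real)"
  unfolding cauchy_weight_def[abs_def]
  by (intro integrable_prod_vec integrable_inverse_1_plus_square_real)

text \<open>The reciprocal of the weight is at most (1 + |x|^2)^n, hence at most 2^n (1 + |x|^(2n));
  the constant comes from the decay bounds for the exponents 0 and 2n.\<close>

lemma cauchy_weight_bound:
  fixes f :: "real^'n::finite \<Rightarrow> 'a::real_normed_vector"
  assumes f: "\<And>k::nat. bounded (range (\<lambda>x. norm x ^ k * norm (f x)))"
  obtains C where "0 \<le> C" "\<And>x. norm (f x) \<le> C * cauchy_weight x"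
proof -
  let ?n = "CARD('n)"
  obtain B0 where B0: "norm (f x) \<le> B0" for x
    using f[of 0] unfolding bounded_iff by auto
  obtain B1 where B1: "norm x ^ (2 * ?n) * norm (f x) \<le> B1" for x
    using f[of "2 * ?n"] unfolding bounded_iff by (auto simp: abs_mult)
  have B0_nn: "0 \<le> B0" and B1_nn: "0 \<le> B1"
    using B0[of 0] B1[of 0] by (auto intro: order_trans[OF norm_ge_zero] order_trans[rotated])
  show ?thesis
  proof (rule that[of "2 ^ ?n * (B0 + B1)"])
    show "0 \<le> 2 ^ ?n * (B0 + B1)" using B0_nn B1_nn by simp
    fix x :: "real^'n"
    have xi: "(x $ i)\<^sup>2 \<le> (norm x)\<^sup>2" for i
      using component_le_norm_cart[of x i] abs_le_square_iff[of "x $ i" "norm x"] by simp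
    have "(\<Prod>i\<in>UNIV. 1 + (x $ i)\<^sup>2) \<le> (\<Prod>i\<in>(UNIV::'n set). 1 + (norm x)\<^sup>2)"
      by (intro prod_mono) (use xi in auto)
    also have "\<dots> = (1 + (norm x)\<^sup>2) ^ ?n" by simp
    also have "\<dots> \<le> (2 * max 1 ((norm x)\<^sup>2)) ^ ?n"
      by (intro power_mono) auto
    also have "\<dots> = 2 ^ ?n * max 1 ((norm x)\<^sup>2) ^ ?n" by (simp add: power_mult_distrib)
    also have "max 1 ((norm x)\<^sup>2) ^ ?n \<le> 1 + norm x ^ (2 * ?n)"
      by (cases "1 \<le> (norm x)\<^sup>2") (auto simp: max_def power_mult)
    finally have "norm (f x) * (\<Prod>i\<in>UNIV. 1 + (x $ i)\<^sup>2) \<le> norm (f x) * (2 ^ ?n * (1 + norm x ^ (2 * ?n)))"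
      by (intro mult_left_mono) auto
    also have "\<dots> = 2 ^ ?n * (norm (f x) + norm x ^ (2 * ?n) * norm (f x))"
      by (simp add: algebra_simps)
    also have "\<dots> \<le> 2 ^ ?n * (B0 + B1)"
      by (intro mult_left_mono add_mono B0 B1) auto
    finally show "norm (f x) \<le> 2 ^ ?n * (B0 + B1) * cauchy_weight x"
      unfolding cauchy_weight_def prod_inversef[unfolded comp_def]
      by (subst divide_inverse[symmetric], subst pos_le_divide_eq) (auto intro!: prod_pos add_pos_nonneg)
  qed
qed

lemma integrable_rapid_decay:
  fixes f :: "real^'n::finite \<Rightarrow> 'a::{banach, second_countable_topology}"
  assumes [measurable]: "f \<in> borel_measurable borel"
    and f: "\<And>k::nat. bounded (range (\<lambda>x. norm x ^ k * norm (f x)))"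
  shows "integrable lborel f"
proof -
  obtain C where C: "0 \<le> C" "\<And>x. norm (f x) \<le> C * cauchy_weight x"
    using cauchy_weight_bound[OF f] by metis
  show ?thesis
    by (rule Bochner_Integration.integrable_bound[where f = "\<lambda>x. C * cauchy_weight x"])
       (use C in \<open>auto simp: integrable_cauchy_weight abs_mult abs_of_pos cauchy_weight_pos\<close>)
qed

text \<open>A shift by at most 1 changes the one factor that it touches by at most 3, as completing
  the square shows. This gives one integrable majorant for all difference quotients in
  \<open>fourier_partial\<close>.\<close>

lemma cauchy_weight_shift:
  fixes x :: "real^'n::finite"
  assumes t: "0 \<le> t" "t \<le> 1"
  shows "cauchy_weight (x + t *\<^sub>R axis j 1) \<le> 3 ^ CARD('n) * cauchy_weight x"
proof -
  have le: "1 + a\<^sup>2 \<le> 3 * (1 + (a + b)\<^sup>2)" if "\<bar>b\<bar> \<le> 1" for a b :: real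
  proof -
    have "b\<^sup>2 \<le> 1" using that by (simp add: abs_square_le_1)
    moreover have "3 * (1 + (a + b)\<^sup>2) - (1 + a\<^sup>2) = 2 * (a + 3 * b / 2)\<^sup>2 + 2 - 3 * b\<^sup>2 / 2"
      by (simp add: power2_eq_square algebra_simps)
    moreover have "0 \<le> (a + 3 * b / 2)\<^sup>2" by simp
    ultimately show ?thesis by linarith
  qed
  have "cauchy_weight (x + t *\<^sub>R axis j 1) \<le> (\<Prod>i\<in>(UNIV::'n set). 3 * inverse (1 + (x $ i)\<^sup>2))"
    unfolding cauchy_weight_def
  proof (intro prod_mono conjI)
    fix i
    have "\<bar>(t *\<^sub>R axis j 1 :: real^'n) $ i\<bar> \<le> 1" using t by (simp add: axis_def)
    from le[OF this, of "x $ i"]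
    show "inverse (1 + ((x + t *\<^sub>R axis j 1) $ i)\<^sup>2) \<le> 3 * inverse (1 + (x $ i)\<^sup>2)"
      by (simp add: field_simps add_pos_nonneg)
    show "0 \<le> inverse (1 + ((x + t *\<^sub>R axis j 1) $ i)\<^sup>2)" by simp
  qed
  then show ?thesis by (simp add: cauchy_weight_def prod.distrib)
qed

section \<open>Partial derivatives and closure properties of the Schwartz class\<close>

lemma partial_eqI: "(f has_derivative f') (at x) \<Longrightarrow> partial j f x = f' (axis j 1)"
  unfolding partial_def by (metis frechet_derivative_at)

lemma has_real_derivative_along_axis:
  fixes f :: "real^'n::finite \<Rightarrow> real"
  assumes "f differentiable (at (x + t *\<^sub>R axis j 1))"
  shows "((\<lambda>t. f (x + t *\<^sub>R axis j 1)) has_real_derivative partial j f (x + t *\<^sub>R axis j 1)) (at t)"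
proof -
  let ?D = "frechet_derivative f (at (x + t *\<^sub>R axis j 1))"
  have f: "(f has_derivative ?D) (at (x + t *\<^sub>R axis j 1))"
    using assms frechet_derivative_works by blast
  interpret bounded_linear ?D using f by (rule has_derivative_bounded_linear)
  have "((\<lambda>t. x + t *\<^sub>R (axis j 1 :: real^'n)) has_derivative (\<lambda>h. h *\<^sub>R axis j 1)) (at t)"
    by (auto intro!: derivative_eq_intros)
  from has_derivative_compose[OF this f]
  moreover have "(*) (?D (axis j 1)) = (\<lambda>h. h * ?D (axis j 1))" by (simp add: fun_eq_iff)
  ultimately show ?thesis
    unfolding has_field_derivative_def partial_def scaleR by simp
qed

lemma iterated_partial_append:
  "iterated_partial (ks @ js) u = iterated_partial ks (iterated_partial js u)"
  by (induction ks) auto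

lemma schwartz_differentiable: "u \<in> schwartz \<Longrightarrow> u differentiable (at x)"
  unfolding schwartz_def by (auto dest!: spec[of _ "[]"])

lemma schwartz_bounded: "u \<in> schwartz \<Longrightarrow> bounded (range (\<lambda>x. norm x ^ k * norm (u x)))"
  unfolding schwartz_def bounded_iff
  by (drule CollectD, drule spec[of _ "[]"], drule conjunct2, drule spec[of _ k]) (simp add: abs_mult)

lemma schwartz_iterated_partial: "u \<in> schwartz \<Longrightarrow> iterated_partial js u \<in> schwartz"
  unfolding schwartz_def by (simp add: iterated_partial_append[symmetric])

lemma schwartz_partial: "u \<in> schwartz \<Longrightarrow> partial j u \<in> schwartz"
  using schwartz_iterated_partial[of u "[j]"] by simp

lemma schwartz_continuous: "u \<in> schwartz \<Longrightarrow> continuous_on UNIV u"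
  by (intro continuous_at_imp_continuous_on ballI differentiable_imp_continuous_within schwartz_differentiable)

lemma borel_measurable_schwartz [measurable_dest]: "u \<in> schwartz \<Longrightarrow> u \<in> borel_measurable borel"
  by (intro borel_measurable_continuous_onI schwartz_continuous)

lemma integrable_schwartz: "u \<in> schwartz \<Longrightarrow> integrable lborel (\<lambda>x. complex_of_real (u x))"
  by (intro integrable_rapid_decay borel_measurable_of_real borel_measurable_schwartz)
     (auto dest: schwartz_bounded)

lemma partial_cmult:
  assumes "\<And>x. u differentiable (at x)"
  shows "partial j (\<lambda>x. c * u x) = (\<lambda>x. c * partial j u x)"
proof
  fix x
  have "(u has_derivative frechet_derivative u (at x)) (at x)"
    using assms frechet_derivative_works by blast
  then have "((\<lambda>x. c * u x) has_derivative (\<lambda>h. c * frechet_derivative u (at x) h)) (at x)"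
    by (rule has_derivative_mult_right)
  from partial_eqI[OF this] show "partial j (\<lambda>x. c * u x) x = c * partial j u x"
    by (simp add: partial_def)
qed

lemma iterated_partial_cmult:
  assumes "u \<in> schwartz"
  shows "iterated_partial js (\<lambda>x. c * u x) = (\<lambda>x. c * iterated_partial js u x)"
  by (induction js)
     (simp_all add: partial_cmult schwartz_differentiable[OF schwartz_iterated_partial[OF assms]])

lemma schwartz_cmult:
  assumes u: "u \<in> schwartz"
  shows "(\<lambda>x. c * u x) \<in> schwartz"
  unfolding schwartz_def mem_Collect_eq iterated_partial_cmult[OF u]
proof (intro allI conjI)
  fix js x k
  show "(\<lambda>x. c * iterated_partial js u x) differentiable (at x)"
    by (intro differentiable_mult differentiable_const schwartz_differentiable schwartz_iterated_partial u)
  have "bounded (range (\<lambda>x. norm x ^ k * iterated_partial js u x))"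
    using u by (simp add: schwartz_def)
  then have "bounded ((\<lambda>y. c * y) ` range (\<lambda>x. norm x ^ k * iterated_partial js u x))"
    by (rule bounded_linear_image) (rule bounded_linear_mult_right)
  then show "bounded (range (\<lambda>x. norm x ^ k * (c * iterated_partial js u x)))"
    by (simp add: image_image mult_ac)
qed

text \<open>Instead of integrating by parts, translation turns the difference quotient of \<open>u\<close> into a
  factor on the Fourier side.\<close>

lemma fourier_partial:
  fixes u :: "real^'n::finite \<Rightarrow> real"
  assumes u: "u \<in> schwartz"
  shows "fourier (\<lambda>x. of_real (partial j u x)) \<xi> =
    2 * of_real pi * \<i> * of_real (\<xi> $ j) * fourier (\<lambda>x. of_real (u x)) \<xi>"
proof -
  note [measurable] = borel_measurable_schwartz[OF u] borel_measurable_schwartz[OF schwartz_partial[OF u], of j]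
  let ?e = "axis j 1 :: real^'n"
  let ?c = "\<lambda>x. cis (- (2 * pi * (x \<bullet> \<xi>)))"
  \<comment> \<open>The steps lie in the interval (0, 1], where \<open>cauchy_weight_shift\<close>
    applies.\<close>
  define h where "h k = 1 / real (Suc k)" for k
  have h: "0 < h k" "h k \<le> 1" for k by (auto simp: h_def)
  have h0: "h \<longlonglongrightarrow> 0" unfolding h_def by (rule LIMSEQ_Suc) (rule lim_1_over_n)
  then have h0': "filterlim h (at 0) sequentially"
    using h(1) by (intro filterlim_atI) (auto simp: less_imp_neq[THEN not_sym])
  define q where "q k x = (u (x + h k *\<^sub>R ?e) - u x) / h k" for k x
  obtain C where C: "0 \<le> C" "\<And>x. norm (partial j u x) \<le> C * cauchy_weight x"
    using cauchy_weight_bound[OF schwartz_bounded[OF schwartz_partial[OF u]]] by metis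
  have "(\<lambda>k. LINT x|lborel. of_real (q k x) * ?c x) \<longlonglongrightarrow> (LINT x|lborel. of_real (partial j u x) * ?c x)"
  proof (rule integral_dominated_convergence[where w = "\<lambda>x. C * (3 ^ CARD('n) * cauchy_weight x)"])
    show "integrable lborel (\<lambda>x::real^'n. C * (3 ^ CARD('n) * cauchy_weight x))"
      by (simp add: integrable_cauchy_weight)
    show "AE x in lborel. (\<lambda>k. of_real (q k x) * ?c x) \<longlonglongrightarrow> of_real (partial j u x) * ?c x"
    proof (intro AE_I2 tendsto_intros)
      fix x
      have "((\<lambda>t. (u (x + t *\<^sub>R ?e) - u x) / t) \<longlongrightarrow> partial j u x) (at 0)"
        using has_real_derivative_along_axis[OF schwartz_differentiable[OF u], where x = x and t = 0 and j = j]
        by (simp add: DERIV_def)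
      from filterlim_compose[OF this h0'] show "(\<lambda>k. q k x) \<longlonglongrightarrow> partial j u x"
        by (simp add: q_def)
    qed
    show "AE x in lborel. norm (of_real (q k x) * ?c x) \<le> C * (3 ^ CARD('n) * cauchy_weight x)" for k
    proof (rule AE_I2)
      fix x
      \<comment> \<open>By the mean value theorem the quotient is a value of the partial derivative
        at distance less than \<open>h k\<close> from \<open>x\<close>, so the shifted weight
        dominates it.\<close>
      obtain z where z: "0 < z" "z < h k" "u (x + h k *\<^sub>R ?e) - u (x + 0 *\<^sub>R ?e) = (h k - 0) * partial j u (x + z *\<^sub>R ?e)"
        using MVT2[OF h(1)[of k], of "\<lambda>t. u (x + t *\<^sub>R ?e)" "\<lambda>t. partial j u (x + t *\<^sub>R ?e)"]
          has_real_derivative_along_axis[OF schwartz_differentiable[OF u]] by metis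
      then have "q k x = partial j u (x + z *\<^sub>R ?e)" using h(1)[of k] by (simp add: q_def)
      also have "norm \<dots> \<le> C * cauchy_weight (x + z *\<^sub>R ?e)" by (rule C)
      also have "\<dots> \<le> C * (3 ^ CARD('n) * cauchy_weight x)"
        using z h(2)[of k] by (intro mult_left_mono C cauchy_weight_shift) auto
      finally show "norm (of_real (q k x) * ?c x) \<le> C * (3 ^ CARD('n) * cauchy_weight x)"
        by (simp add: norm_mult)
    qed
  qed (auto simp: q_def)
  also have "(\<lambda>k. LINT x|lborel. of_real (q k x) * ?c x) =
    (\<lambda>k. (cis (2 * pi * (h k * \<xi> $ j)) - 1) / of_real (h k) * fourier (\<lambda>x. of_real (u x)) \<xi>)"
  proof
    fix k
    have int: "integrable lborel (\<lambda>x. complex_of_real (u x) * ?c x)"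
      by (subst integrable_cis_iff) (auto simp: integrable_schwartz[OF u])
    \<comment> \<open>The factor \<open>1 *\<^sub>R x\<close> is kept so that the translation has
      the form of \<open>lborel_integral_affine\<close> with scale 1.\<close>
    have eq: "of_real (u (x + h k *\<^sub>R ?e)) * ?c x =
        cis (2 * pi * (h k * \<xi> $ j)) * (of_real (u (h k *\<^sub>R ?e + 1 *\<^sub>R x)) * ?c (h k *\<^sub>R ?e + 1 *\<^sub>R x))" for x
      by (simp add: inner_add_left inner_axis' cis_mult add.commute mult.left_commute[of "cis _"] algebra_simps)
    have shift: "integrable lborel (\<lambda>x. complex_of_real (u (x + h k *\<^sub>R ?e)) * ?c x)"
    proof -
      have "integrable (distr lborel borel ((+) (h k *\<^sub>R ?e))) (\<lambda>x. complex_of_real (u x) * ?c x)"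
        by (subst lborel_distr_plus) (rule int)
      then have "integrable lborel (\<lambda>x. complex_of_real (u (h k *\<^sub>R ?e + x)) * ?c (h k *\<^sub>R ?e + x))"
        by (subst (asm) integrable_distr_eq) auto
      then show ?thesis unfolding eq by simp
    qed
    have "(LINT x|lborel. of_real (q k x) * ?c x) =
      (LINT x|lborel. (of_real (u (x + h k *\<^sub>R ?e)) * ?c x - of_real (u x) * ?c x) / of_real (h k))"
      by (simp add: q_def field_simps)
    also have "\<dots> = ((LINT x|lborel. of_real (u (x + h k *\<^sub>R ?e)) * ?c x) - fourier (\<lambda>x. of_real (u x)) \<xi>) / of_real (h k)"
      by (simp add: Bochner_Integration.integral_diff[OF shift int] fourier_eq_cis)
    also have "(LINT x|lborel. of_real (u (x + h k *\<^sub>R ?e)) * ?c x) =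
        cis (2 * pi * (h k * \<xi> $ j)) * (LINT x|lborel. of_real (u (h k *\<^sub>R ?e + 1 *\<^sub>R x)) * ?c (h k *\<^sub>R ?e + 1 *\<^sub>R x))"
      unfolding eq by simp
    also have "(LINT x|lborel. of_real (u (h k *\<^sub>R ?e + 1 *\<^sub>R x)) * ?c (h k *\<^sub>R ?e + 1 *\<^sub>R x)) = fourier (\<lambda>x. of_real (u x)) \<xi>"
      unfolding fourier_eq_cis
      by (subst lborel_integral_affine[of "\<lambda>x. of_real (u x) * ?c x" 1 "h k *\<^sub>R ?e"]) auto
    finally show "(LINT x|lborel. of_real (q k x) * ?c x) =
       (cis (2 * pi * (h k * \<xi> $ j)) - 1) / of_real (h k) * fourier (\<lambda>x. of_real (u x)) \<xi>"
      by (simp add: field_simps)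
  qed
  finally have lim: "(\<lambda>k. (cis (2 * pi * (h k * \<xi> $ j)) - 1) / of_real (h k) * fourier (\<lambda>x. of_real (u x)) \<xi>)
     \<longlonglongrightarrow> fourier (\<lambda>x. of_real (partial j u x)) \<xi>"
    unfolding fourier_eq_cis[of "\<lambda>x. of_real (partial j u x)"] .
  define a where "a = 2 * of_real pi * \<i> * of_real (\<xi> $ j)"
  have "((\<lambda>z. exp (a * z)) has_field_derivative a) (at 0)"
    by (auto intro!: derivative_eq_intros)
  then have "((\<lambda>z. (exp (a * z) - 1) / z) \<longlongrightarrow> a) (at 0)"
    by (simp add: DERIV_def)
  moreover have "filterlim (\<lambda>k. complex_of_real (h k)) (at 0) sequentially"
    using h(1) tendsto_of_real[OF h0, where 'a=complex]
    by (intro filterlim_atI) (auto simp: less_imp_neq[THEN not_sym])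
  ultimately have "(\<lambda>k. (exp (a * of_real (h k)) - 1) / of_real (h k)) \<longlonglongrightarrow> a"
    by (rule filterlim_compose)
  then have "(\<lambda>k. (cis (2 * pi * (h k * \<xi> $ j)) - 1) / of_real (h k) * fourier (\<lambda>x. of_real (u x)) \<xi>) \<longlonglongrightarrow> a * fourier (\<lambda>x. of_real (u x)) \<xi>"
    by (intro tendsto_mult tendsto_const) (simp add: a_def cis_conv_exp mult_ac)
  from LIMSEQ_unique[OF lim this] show ?thesis by (simp add: a_def)
qed

lemma fourier_iterated_partial:
  fixes u :: "real^'n::finite \<Rightarrow> real"
  assumes u: "u \<in> schwartz"
  shows "fourier (\<lambda>x. of_real (iterated_partial (replicate k j) u x)) \<xi> =
    (2 * of_real pi * \<i> * of_real (\<xi> $ j)) ^ k * fourier (\<lambda>x. of_real (u x)) \<xi>"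
  by (induction k) (simp_all add: fourier_partial schwartz_iterated_partial u)

text \<open>The transform of the \<open>k\<close>-th derivative in direction \<open>j\<close> is
  bounded by an L1 norm, which controls the \<open>k\<close>-th power of the coordinate
  \<open>j\<close>. The largest coordinate controls the norm up to the factor n, and it depends on
  \<xi>, whence the sum over all \<open>j\<close> in the bound.\<close>

lemma fourier_schwartz_bounded:
  fixes u :: "real^'n::finite \<Rightarrow> real"
  assumes u: "u \<in> schwartz"
  shows "bounded (range (\<lambda>\<xi>. norm \<xi> ^ k * norm (fourier (\<lambda>x. of_real (u x)) \<xi>)))"
proof -
  let ?n = "real CARD('n)"
  define C where "C j = (LINT x|lborel. norm (complex_of_real (iterated_partial (replicate k j) u x)))" for j
  have C: "\<bar>\<xi> $ j\<bar> ^ k * norm (fourier (\<lambda>x. of_real (u x)) \<xi>) \<le> C j" for \<xi> j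
  proof -
    have "\<bar>\<xi> $ j\<bar> ^ k \<le> (2 * pi * \<bar>\<xi> $ j\<bar>) ^ k"
      using pi_gt3 by (intro power_mono) (auto intro: mult_le_cancel_right1[THEN iffD2])
    then have "\<bar>\<xi> $ j\<bar> ^ k * norm (fourier (\<lambda>x. of_real (u x)) \<xi>) \<le>
        norm (fourier (\<lambda>x. of_real (iterated_partial (replicate k j) u x)) \<xi>)"
      unfolding fourier_iterated_partial[OF u] norm_mult norm_power
      by (intro mult_right_mono) (auto simp: norm_mult)
    also have "\<dots> \<le> C j" unfolding C_def by (rule norm_fourier_le)
    finally show ?thesis .
  qed
  have "norm \<xi> ^ k * norm (fourier (\<lambda>x. of_real (u x)) \<xi>) \<le> ?n ^ k * (\<Sum>j\<in>UNIV. C j)" for \<xi>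
  proof -
    define M where "M = (MAX j. \<bar>\<xi> $ j\<bar>)"
    obtain j where j: "M = \<bar>\<xi> $ j\<bar>"
      using Max_in[of "range (\<lambda>j. \<bar>\<xi> $ j\<bar>)"] unfolding M_def by fastforce
    have "norm \<xi> \<le> (\<Sum>j\<in>UNIV. \<bar>\<xi> $ j\<bar>)" by (rule norm_le_l1_cart)
    also have "\<dots> \<le> ?n * \<bar>\<xi> $ j\<bar>"
      unfolding j[symmetric] by (rule sum_bounded_above) (auto simp: M_def)
    finally have "norm \<xi> ^ k \<le> ?n ^ k * \<bar>\<xi> $ j\<bar> ^ k"
      by (simp add: power_mono flip: power_mult_distrib)
    then have "norm \<xi> ^ k * norm (fourier (\<lambda>x. of_real (u x)) \<xi>) \<le> ?n ^ k * (\<bar>\<xi> $ j\<bar> ^ k * norm (fourier (\<lambda>x. of_real (u x)) \<xi>))"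
      by (simp add: mult_right_mono flip: mult.assoc)
    also have "\<dots> \<le> ?n ^ k * C j" by (intro mult_left_mono C) auto
    also have "C j \<le> (\<Sum>j\<in>UNIV. C j)"
      by (rule member_le_sum) (auto simp: C_def)
    finally show ?thesis by (simp add: mult_left_mono)
  qed
  then show ?thesis unfolding bounded_iff by (intro exI[of _ "?n ^ k * (\<Sum>j\<in>UNIV. C j)"]) (auto simp: abs_mult)
qed

lemma integrable_fourier_schwartz:
  fixes u :: "real^'n::finite \<Rightarrow> real"
  shows "u \<in> schwartz \<Longrightarrow> integrable lborel (fourier (\<lambda>x. of_real (u x)))"
  by (intro integrable_rapid_decay borel_measurable_fourier fourier_schwartz_bounded
      borel_measurable_integrable[OF integrable_schwartz, unfolded measurable_lborel2])

lemma fourier_fourier_schwartz: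
  fixes u :: "real^'n::finite \<Rightarrow> real"
  assumes u: "u \<in> schwartz"
  shows "fourier (fourier (\<lambda>x. of_real (u x))) \<eta> = of_real (u (- \<eta>))"
proof -
  obtain B where B: "norm (u x) \<le> B" for x
    using schwartz_bounded[OF u, of 0] unfolding bounded_iff by auto
  show ?thesis
    by (rule fourier_fourier[where B = B])
       (auto intro: integrable_schwartz integrable_fourier_schwartz u continuous_on_of_real schwartz_continuous B[simplified])
qed

section \<open>A lower bound for multiplier norms\<close>

lemma lborel_integrable_affine:
  fixes f :: "'a::euclidean_space \<Rightarrow> 'b::{banach, second_countable_topology}"
  assumes f: "integrable lborel f" and c: "c \<noteq> 0"
  shows "integrable lborel (\<lambda>x. f (t + c *\<^sub>R x))"
proof -
  have [measurable]: "f \<in> borel_measurable borel" using f by auto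
  have "integrable (density (distr lborel borel (\<lambda>x. t + c *\<^sub>R x)) (\<lambda>_. \<bar>c\<bar> ^ DIM('a))) f"
    using f by (subst lborel_affine[OF c, of t, symmetric])
  then have "integrable (distr lborel borel (\<lambda>x. t + c *\<^sub>R x)) (\<lambda>x. \<bar>c\<bar> ^ DIM('a) *\<^sub>R f x)"
    by (subst (asm) integrable_density) auto
  then have "integrable lborel (\<lambda>x. \<bar>c\<bar> ^ DIM('a) *\<^sub>R f (t + c *\<^sub>R x))"
    by (subst (asm) integrable_distr_eq) auto
  from integrable_scaleR_right[OF this, of "1 / \<bar>c\<bar> ^ DIM('a)"] show ?thesis
    using c by simp
qed

lemma lborel_integrable_reflect:
  fixes f :: "'a::euclidean_space \<Rightarrow> 'b::{banach, second_countable_topology}"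
  shows "integrable lborel f \<Longrightarrow> integrable lborel (\<lambda>x. f (- x))"
  using lborel_integrable_affine[of f "-1" 0] by simp

lemma lborel_integral_reflect:
  fixes f :: "'a::euclidean_space \<Rightarrow> 'b::{banach, second_countable_topology}"
  shows "f \<in> borel_measurable borel \<Longrightarrow> (LINT x|lborel. f (- x)) = (LINT x|lborel. f x)"
  using lborel_integral_affine[of f "-1" 0] by simp

lemma fourier_reflect:
  fixes f :: "real^'n::finite \<Rightarrow> complex"
  assumes [measurable]: "f \<in> borel_measurable borel"
  shows "fourier (\<lambda>x. f (- x)) \<xi> = fourier f (- \<xi>)"
  unfolding fourier_eq_cis
  using lborel_integral_reflect[of "\<lambda>x. f x * cis (2 * pi * (x \<bullet> \<xi>))"] by simp

text \<open>The symbol grows at most linearly, so the rapid decay of the transform absorbs it. These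
  are the hypotheses of \<open>fourier_fourier\<close> on \<open>g\<close> itself; the remaining
  one, integrability of \<open>fourier g\<close>, will come from a finite multiplier norm.\<close>

lemma multiplier_schwartz:
  fixes u :: "real^'n::finite \<Rightarrow> real"
  assumes u: "u \<in> schwartz" and m: "continuous_on UNIV m"
    and s: "0 < s" "s < 1" and le: "\<And>\<xi>. norm (m \<xi>) \<le> (2 * pi * norm \<xi>) powr s"
  defines "g \<equiv> \<lambda>\<xi>. m \<xi> * fourier (\<lambda>x. of_real (u x)) \<xi>"
  shows "integrable lborel g" "continuous_on UNIV g" "\<exists>B. \<forall>\<xi>. norm (g \<xi>) \<le> B"
proof -
  show cont: "continuous_on UNIV g"
    unfolding g_def by (intro continuous_intros m continuous_on_fourier integrable_schwartz u)
  have le': "norm (m \<xi>) \<le> 1 + 2 * pi * norm \<xi>" for \<xi>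
  proof (cases "2 * pi * norm \<xi> \<le> 1")
    case True
    then have "(2 * pi * norm \<xi>) powr s \<le> 1" using s by (intro powr_le1) auto
    then show ?thesis using le[of \<xi>] by (smt (verit) mult_nonneg_nonneg norm_ge_zero pi_ge_zero)
  next
    case False
    then have "(2 * pi * norm \<xi>) powr s \<le> (2 * pi * norm \<xi>) powr 1" using s by (intro powr_mono) auto
    then show ?thesis using le[of \<xi>] False by auto
  qed
  have bdd: "bounded (range (\<lambda>\<xi>. norm \<xi> ^ k * norm (g \<xi>)))" for k
  proof -
    let ?N = "\<lambda>\<xi>. norm (fourier (\<lambda>x. of_real (u x)) \<xi>)"
    obtain B where B: "norm \<xi> ^ k * ?N \<xi> \<le> B" for \<xi>
      using fourier_schwartz_bounded[OF u, of k] unfolding bounded_iff by (auto simp: abs_mult)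
    obtain B' where B': "norm \<xi> ^ Suc k * ?N \<xi> \<le> B'" for \<xi>
      using fourier_schwartz_bounded[OF u, of "Suc k"] unfolding bounded_iff by (auto simp: abs_mult)
    have "norm \<xi> ^ k * norm (g \<xi>) \<le> B + 2 * pi * B'" for \<xi>
    proof -
      have "norm \<xi> ^ k * norm (g \<xi>) \<le> norm \<xi> ^ k * ((1 + 2 * pi * norm \<xi>) * ?N \<xi>)"
        unfolding g_def norm_mult by (intro mult_left_mono mult_right_mono le') auto
      also have "\<dots> = norm \<xi> ^ k * ?N \<xi> + 2 * pi * (norm \<xi> ^ Suc k * ?N \<xi>)"
        by (simp add: algebra_simps)
      also have "\<dots> \<le> B + 2 * pi * B'" by (intro add_mono mult_left_mono B B') auto
      finally show ?thesis .
    qed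
    then show ?thesis unfolding bounded_iff by (auto simp: abs_mult)
  qed
  then show "integrable lborel g"
    by (intro integrable_rapid_decay borel_measurable_continuous_onI cont)
  show "\<exists>B. \<forall>\<xi>. norm (g \<xi>) \<le> B"
    using bdd[of 0] unfolding bounded_iff by auto
qed

text \<open>Pairing \<open>u\<close> with \<open>\<phi>\<close> is pairing the multiplied \<open>u\<close> with the bounded potential
  whose transform is \<open>\<theta>\<close>, the transform of \<open>\<phi>\<close> divided by the multiplier.\<close>

lemma multiplier_duality:
  fixes u :: "real^'n::finite \<Rightarrow> real"
  assumes u: "u \<in> schwartz" and m: "continuous_on UNIV m"
    and s: "0 < s" "s < 1" and le: "\<And>\<xi>. norm (m \<xi>) \<le> (2 * pi * norm \<xi>) powr s"
    and \<phi>: "integrable lborel \<phi>" and \<theta>: "integrable lborel \<theta>"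
    and \<theta>_eq: "AE \<xi> in lborel. m \<xi> * \<theta> \<xi> = fourier \<phi> (- \<xi>)"
    and fin: "L1_norm (fourier_multiplier m u) < \<infinity>"
  shows "norm (LINT x|lborel. of_real (u x) * \<phi> x) \<le>
    enn2real (L1_norm (fourier_multiplier m u)) * (LINT \<xi>|lborel. norm (\<theta> \<xi>))"
proof -
  let ?U = "fourier (\<lambda>x. of_real (u x))"
  define g where "g \<xi> = m \<xi> * ?U \<xi>" for \<xi>
  note g = multiplier_schwartz[OF u m s le, folded g_def[abs_def]]
  define f where "f = fourier_multiplier m u"
  have f_eq: "f x = fourier g (- x)" for x
    unfolding f_def fourier_multiplier_def inverse_fourier_eq g_def[abs_def] ..
  have [measurable]: "g \<in> borel_measurable borel" "\<phi> \<in> borel_measurable borel" "\<theta> \<in> borel_measurable borel"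
    "fourier g \<in> borel_measurable borel" "?U \<in> borel_measurable borel" "m \<in> borel_measurable borel"
    "u \<in> borel_measurable borel"
    using g(1) \<phi> \<theta> integrable_fourier_schwartz[OF u] borel_measurable_continuous_onI[OF m]
      borel_measurable_schwartz[OF u]
    by auto
  have [measurable]: "f \<in> borel_measurable borel" unfolding f_eq[abs_def] by measurable
  \<comment> \<open>Finiteness of the norm supplies the integrability of \<open>fourier g\<close>,
    so inversion applies and \<open>Ff\<close> recovers \<open>g\<close> from
    \<open>f\<close>.\<close>
  have f: "integrable lborel f"
    using fin unfolding f_def[symmetric] L1_norm_def by (intro integrableI_bounded) auto
  have "integrable lborel (\<lambda>x. f (- x))" using f by (rule lborel_integrable_reflect)
  then have Fg: "integrable lborel (fourier g)" by (simp add: f_eq)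
  obtain B where B: "\<And>\<xi>. norm (g \<xi>) \<le> B" using g(3) by (auto simp: g_def)
  have Ff: "fourier f \<xi> = g \<xi>" for \<xi>
  proof -
    have "fourier f \<xi> = fourier (fourier g) (- \<xi>)"
      unfolding f_eq[abs_def] by (rule fourier_reflect) simp
    then show ?thesis using fourier_fourier[OF g(1,2) B Fg, of "- \<xi>"] by simp
  qed
  \<comment> \<open>The multiplication formula enters twice: here it moves the transform from
    \<theta> to \<open>f\<close>, and below from the reflected \<phi> to \<open>?U\<close>, where
    inversion gives back \<open>u\<close>.\<close>
  have "(LINT x|lborel. f x * fourier \<theta> x) = (LINT \<xi>|lborel. g \<xi> * \<theta> \<xi>)"
    using fourier_multiplication_formula[OF f \<theta>] by (simp add: Ff)
  also have "\<dots> = (LINT \<xi>|lborel. ?U \<xi> * fourier (\<lambda>x. \<phi> (- x)) \<xi>)"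
  proof (rule Bochner_Integration.integral_cong_AE)
    show "AE \<xi> in lborel. g \<xi> * \<theta> \<xi> = ?U \<xi> * fourier (\<lambda>x. \<phi> (- x)) \<xi>"
      using \<theta>_eq
    proof eventually_elim
      case (elim \<xi>)
      then show ?case by (simp add: g_def fourier_reflect mult_ac)
    qed
    qed simp_all
  also have "\<dots> = (LINT x|lborel. fourier ?U x * \<phi> (- x))"
    by (rule fourier_multiplication_formula[OF integrable_fourier_schwartz[OF u] lborel_integrable_reflect[OF \<phi>]])
  also have "\<dots> = (LINT x|lborel. of_real (u x) * \<phi> x)"
    unfolding fourier_fourier_schwartz[OF u]
    by (rule lborel_integral_reflect[where f = "\<lambda>x. of_real (u x) * \<phi> x"]) simp
  finally have "norm (LINT x|lborel. of_real (u x) * \<phi> x) = norm (LINT x|lborel. f x * fourier \<theta> x)" by simp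
  also have "\<dots> \<le> (LINT x|lborel. norm (f x * fourier \<theta> x))" by (rule integral_norm_bound)
  also have "\<dots> \<le> (LINT x|lborel. norm (f x) * (LINT \<xi>|lborel. norm (\<theta> \<xi>)))"
  proof (rule integral_mono')
    show "integrable lborel (\<lambda>x. norm (f x) * (LINT \<xi>|lborel. norm (\<theta> \<xi>)))"
      using f by simp
    show "norm (f x * fourier \<theta> x) \<le> norm (f x) * (LINT \<xi>|lborel. norm (\<theta> \<xi>))" for x
      unfolding norm_mult by (intro mult_left_mono norm_fourier_le) auto
    show "0 \<le> norm (f x) * (LINT \<xi>|lborel. norm (\<theta> \<xi>))" for x by simp
  qed
  also have "\<dots> = (LINT x|lborel. norm (f x)) * (LINT \<xi>|lborel. norm (\<theta> \<xi>))" by simp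
  also have "(LINT x|lborel. norm (f x)) = enn2real (L1_norm f)"
    unfolding L1_norm_def by (rule integral_eq_nn_integral) auto
  finally show ?thesis unfolding f_def .
qed

section \<open>The tent function and its transform\<close>

definition tent :: "real \<Rightarrow> real" where
  "tent t = max 0 (1 - \<bar>t\<bar>)"

lemma tent_nonneg: "0 \<le> tent t"
  and tent_eq_0: "1 \<le> \<bar>t\<bar> \<Longrightarrow> tent t = 0"
  by (auto simp: tent_def)

lemma borel_measurable_tent [measurable]: "tent \<in> borel_measurable borel"
  unfolding tent_def[abs_def] by measurable

text \<open>This is the right half of the tent; with a complex exponent the left half is the same
  formula at \<open>- b\<close>.\<close>

lemma integral_ramp_exp:
  fixes b :: complex
  assumes "b \<noteq> 0"
  shows "(LINT t|lborel. indicator {0..1} t *\<^sub>R ((1 - of_real t) * exp (b * of_real t))) = (exp b - 1 - b) / b\<^sup>2"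
proof -
  define F where "F z = (1 - z) * exp (b * z) / b + exp (b * z) / b\<^sup>2" for z
  have "(F has_field_derivative (1 - z) * exp (b * z)) (at z)" for z
    unfolding F_def using assms
    by (auto intro!: derivative_eq_intros simp: field_simps power2_eq_square)
  then have "((\<lambda>t. F (of_real t)) has_vector_derivative (1 - of_real t) * exp (b * of_real t)) (at t within {0..1})" for t :: real
    by (rule has_vector_derivative_real_field)
  then have "(LINT t|lborel. indicator {0..1} t *\<^sub>R ((1 - of_real t) * exp (b * of_real t))) = F (of_real 1) - F (of_real 0)"
    by (intro integral_FTC_Icc) (auto intro!: continuous_intros)
  also have "\<dots> = (exp b - 1 - b) / b\<^sup>2"
    using assms by (simp add: F_def field_simps power2_eq_square)
  finally show ?thesis .
qed

lemma
  shows integrable_tent: "integrable lborel tent"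
    and integral_tent: "(LINT t|lborel. tent t) = 1"
proof -
  have "((\<lambda>t. t - t\<^sup>2 / 2) has_vector_derivative 1 - t) (at t within {0..1})" for t :: real
    unfolding has_real_derivative_iff_has_vector_derivative[symmetric]
    by (auto intro!: derivative_eq_intros)
  then have "has_bochner_integral lborel (\<lambda>t::real. indicator {0..1} t *\<^sub>R (1 - t)) ((1 - 1\<^sup>2 / 2) - (0 - 0\<^sup>2 / 2))"
    by (intro has_bochner_integral_FTC_Icc) (auto intro!: continuous_intros)
  then have half: "integrable lborel (\<lambda>t::real. indicator {0..1} t *\<^sub>R (1 - t))"
      "(LINT t|lborel. indicator {0..1} t *\<^sub>R (1 - t)) = (1 / 2 :: real)"
    by (auto simp: has_bochner_integral_iff)
  note half' = lborel_integrable_reflect[OF half(1)]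
  \<comment> \<open>Both halves contain the point 0, so the identity holds only almost
    everywhere.\<close>
  have eq: "AE t in lborel. indicator {0..1} t *\<^sub>R (1 - t) + indicator {0..1} (- t) *\<^sub>R (1 - (- t)) = tent t"
    using AE_lborel_singleton[of "0::real"] by eventually_elim (auto simp: tent_def indicator_def)
  show "integrable lborel tent"
    using Bochner_Integration.integrable_add[OF half(1) half'] eq
    by (subst integrable_cong_AE[OF _ _ eq[THEN AE_mp]]) (auto intro: AE_I2)
  have "(LINT t|lborel. tent t) = (LINT t|lborel. indicator {0..1} t *\<^sub>R (1 - t) + indicator {0..1} (- t) *\<^sub>R (1 - (- t)))"
    using eq by (intro Bochner_Integration.integral_cong_AE) (auto elim: eventually_mono)
  also have "\<dots> = 1 / 2 + 1 / 2"
    using Bochner_Integration.integral_add[OF half(1) half']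
      lborel_integral_reflect[of "\<lambda>t::real. indicator {0..1} t *\<^sub>R (1 - t)"] half(2) by simp
  finally show "(LINT t|lborel. tent t) = 1" by simp
qed

text \<open>The value is the Fejer kernel
  \<open>(sin (pi * \<eta>) / (pi * \<eta>))\<^sup>2\<close>. Its quadratic decay is the reason for
  tents instead of indicators, whose transforms are not integrable.\<close>

lemma fourier_tent:
  assumes "\<eta> \<noteq> 0"
  shows "(LINT t|lborel. of_real (tent t) * cis (- (2 * pi * (t * \<eta>)))) = of_real ((1 - cos (2 * pi * \<eta>)) / (2 * pi\<^sup>2 * \<eta>\<^sup>2))"
proof -
  define b where "b = - (2 * of_real pi * \<i> * of_real \<eta>)"
  have b: "b \<noteq> 0" using assms by (simp add: b_def)
  define G where "G b t = indicator {0..1} t *\<^sub>R ((1 - complex_of_real t) * exp (b * of_real t))" for b t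
  have cis: "cis (- (2 * pi * (t * \<eta>))) = exp (b * of_real t)" for t
    by (simp add: b_def cis_conv_exp mult_ac)
  have int: "integrable lborel (G b)" for b
    unfolding G_def by (intro borel_integrable_compact continuous_intros) auto
  have [measurable]: "G b \<in> borel_measurable borel" for b using int[of b] by auto
  have "(LINT t|lborel. of_real (tent t) * cis (- (2 * pi * (t * \<eta>)))) = (LINT t|lborel. G b t + G (- b) (- t))"
    unfolding cis
  proof (rule Bochner_Integration.integral_cong_AE)
    show "AE t in lborel. of_real (tent t) * exp (b * of_real t) = G b t + G (- b) (- t)"
      using AE_lborel_singleton[of "0::real"] by eventually_elim (auto simp: tent_def G_def indicator_def)
  qed auto
  also have "\<dots> = (LINT t|lborel. G b t) + (LINT t|lborel. G (- b) t)"
    using Bochner_Integration.integral_add[OF int lborel_integrable_reflect[OF int], of b "- b"]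
    by (simp add: lborel_integral_reflect)
  also have "\<dots> = (exp b + exp (- b) - 2) / b\<^sup>2"
    using integral_ramp_exp[of b] integral_ramp_exp[of "- b"] b unfolding G_def
    by (simp add: add_divide_distrib[symmetric] diff_divide_distrib[symmetric])
  also have "exp b + exp (- b) = of_real (2 * cos (2 * pi * \<eta>))"
    using cos_exp_eq[of "of_real (2 * pi * \<eta>)"] 
    by (simp add: b_def mult_ac add.commute flip: cos_of_real)
  also have "b\<^sup>2 = - of_real (4 * pi\<^sup>2 * \<eta>\<^sup>2)"
    by (simp add: b_def power_mult_distrib)
  also have "(of_real (2 * cos (2 * pi * \<eta>)) - 2) / - complex_of_real (4 * pi\<^sup>2 * \<eta>\<^sup>2) =
      of_real ((2 * cos (2 * pi * \<eta>) - 2) / - (4 * pi\<^sup>2 * \<eta>\<^sup>2))"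
    by simp
  also have "(2 * cos (2 * pi * \<eta>) - 2) / - (4 * pi\<^sup>2 * \<eta>\<^sup>2) = (1 - cos (2 * pi * \<eta>)) / (2 * pi\<^sup>2 * \<eta>\<^sup>2)"
    using assms by (simp add: field_simps)
  finally show ?thesis .
qed

text \<open>The mass of the tent bounds the transform by 1, the explicit formula bounds it by a
  multiple of \<open>1 / \<eta>\<^sup>2\<close>; adding the two bounds yields the Cauchy
  weight.\<close>

lemma fourier_tent_le:
  "norm (LINT t|lborel. of_real (tent t) * cis (- (2 * pi * (t * \<eta>)))) \<le> 2 * inverse (1 + \<eta>\<^sup>2)"
    (is "norm ?T \<le> _")
proof -
  have T1: "norm ?T \<le> 1"
  proof -
    have "norm ?T \<le> (LINT t|lborel. norm (of_real (tent t) * cis (- (2 * pi * (t * \<eta>)))))"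
      by (rule integral_norm_bound)
    also have "\<dots> = 1" using integral_tent by (simp add: norm_mult tent_nonneg)
    finally show ?thesis .
  qed
  have T2: "\<eta>\<^sup>2 * norm ?T \<le> 1"
  proof (cases "\<eta> = 0")
    case False
    then have "\<eta>\<^sup>2 * norm ?T = \<bar>1 - cos (2 * pi * \<eta>)\<bar> / (2 * pi\<^sup>2)"
      unfolding fourier_tent[OF False] norm_of_real by (simp add: abs_mult)
    also have "\<dots> \<le> 2 / (2 * pi\<^sup>2)"
      using cos_ge_minus_one[of "2 * pi * \<eta>"] cos_le_one[of "2 * pi * \<eta>"]
      by (intro divide_right_mono) auto
    also have "\<dots> \<le> 1"
      using pi_gt3 power_mono[of 1 pi 2] by (simp add: field_simps)
    finally show ?thesis .
  qed simp
  from T1 T2 have "norm ?T * (1 + \<eta>\<^sup>2) \<le> 2" by (simp add: algebra_simps)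
  then show ?thesis by (simp add: field_simps add_pos_nonneg)
qed

text \<open>Near 0 the power is integrable since \<open>s < 1\<close>; beyond 1 it is at most 1 and
  the Cauchy weight takes over.\<close>

lemma integrable_powr_cauchy:
  fixes s :: real
  assumes s: "0 < s" "s < 1"
  shows "integrable lborel (\<lambda>t::real. \<bar>t\<bar> powr (- s) * inverse (1 + t\<^sup>2))"
proof -
  have "(\<lambda>t::real. t powr (- s)) integrable_on {0..1}"
    using s by (intro integrable_on_powr_from_0) auto
  then have "(\<lambda>t::real. t powr (- s)) absolutely_integrable_on {0..1}"
    by (intro nonnegative_absolutely_integrable_1) auto
  then have i1: "integrable lborel (\<lambda>t::real. indicator {0..1} t *\<^sub>R t powr (- s))"
    unfolding set_integrable_def by (subst (asm) integrable_completion) auto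
  have "integrable lborel (\<lambda>t::real. indicator {0..1} t *\<^sub>R t powr (- s) +
      indicator {0..1} (- t) *\<^sub>R (- t) powr (- s) + inverse (1 + t\<^sup>2))"
    by (intro Bochner_Integration.integrable_add i1 lborel_integrable_reflect[OF i1] integrable_inverse_1_plus_square_real)
  then show ?thesis
  proof (rule Bochner_Integration.integrable_bound)
    show "AE t in lborel. norm (\<bar>t\<bar> powr (- s) * inverse (1 + t\<^sup>2)) \<le>
      norm (indicator {0..1} t *\<^sub>R t powr (- s) + indicator {0..1} (- t) *\<^sub>R (- t) powr (- s) + inverse (1 + t\<^sup>2))"
    proof (rule AE_I2)
      fix t :: real
      have inv: "0 \<le> inverse (1 + t\<^sup>2)" "inverse (1 + t\<^sup>2) \<le> 1"
        by (auto simp: inverse_le_1_iff)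
      have nn: "0 \<le> indicator {0..1} t *\<^sub>R t powr (- s)" "0 \<le> indicator {0..1} (- t) *\<^sub>R (- t) powr (- s)"
        by auto
      have "\<bar>t\<bar> powr (- s) * inverse (1 + t\<^sup>2) \<le>
        indicator {0..1} t *\<^sub>R t powr (- s) + indicator {0..1} (- t) *\<^sub>R (- t) powr (- s) + inverse (1 + t\<^sup>2)"
      proof (cases "\<bar>t\<bar> \<le> 1")
        case True
        have "\<bar>t\<bar> powr (- s) * inverse (1 + t\<^sup>2) \<le> \<bar>t\<bar> powr (- s)"
          using inv by (intro mult_left_le) auto
        also have "\<dots> \<le> indicator {0..1} t *\<^sub>R t powr (- s) + indicator {0..1} (- t) *\<^sub>R (- t) powr (- s)"
          using True by (cases "0 \<le> t") (auto simp: indicator_def)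
        finally show ?thesis using inv by linarith
      next
        case False
        then have "\<bar>t\<bar> powr (- s) \<le> \<bar>t\<bar> powr 0" using s by (intro powr_mono) auto
        then have "\<bar>t\<bar> powr (- s) * inverse (1 + t\<^sup>2) \<le> 1 * inverse (1 + t\<^sup>2)"
          using False inv by (intro mult_right_mono) (auto split: if_splits)
        then show ?thesis using nn by linarith
      qed
      then show "norm (\<bar>t\<bar> powr (- s) * inverse (1 + t\<^sup>2)) \<le>
        norm (indicator {0..1} t *\<^sub>R t powr (- s) + indicator {0..1} (- t) *\<^sub>R (- t) powr (- s) + inverse (1 + t\<^sup>2))"
        using nn inv by (simp add: abs_mult)
    qed
  qed measurable
qed

text \<open>Since the norm dominates a single coordinate, the singularity can be moved to that
  coordinate, where \<open>s < 1\<close> makes it integrable in every dimension.\<close>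

lemma integrable_riesz_cauchy_weight:
  fixes s :: real
  assumes s: "0 < s" "s < 1"
  shows "integrable lborel (\<lambda>\<xi>::real^'n::finite. norm \<xi> powr (- s) * cauchy_weight \<xi>)"
proof -
  obtain j :: 'n where True by blast
  define h where "h i t = (if i = j then \<bar>t\<bar> powr (- s) else 1) * inverse (1 + t\<^sup>2)" for i and t :: real
  have "integrable lborel (h i)" for i
    unfolding h_def by (cases "i = j") (auto simp: integrable_powr_cauchy[OF s] integrable_inverse_1_plus_square_real)
  then have "integrable lborel (\<lambda>\<xi>::real^'n. \<Prod>i\<in>UNIV. h i (\<xi> $ i))" by (rule integrable_prod_vec)
  moreover have "(\<Prod>i\<in>UNIV. h i (\<xi> $ i)) = \<bar>\<xi> $ j\<bar> powr (- s) * cauchy_weight \<xi>" for \<xi>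
    unfolding h_def prod.distrib cauchy_weight_def by (simp add: prod.delta)
  ultimately have "integrable lborel (\<lambda>\<xi>::real^'n. \<bar>\<xi> $ j\<bar> powr (- s) * cauchy_weight \<xi>)" by simp
  then show ?thesis
  proof (rule Bochner_Integration.integrable_bound)
    \<comment> \<open>Where the coordinate vanishes, \<open>0 powr (- s)\<close> is 0 and the
      majorant breaks down; that hyperplane is a null set.\<close>
    have "AE \<xi>::real^'n in lborel. \<xi> \<bullet> axis j 1 \<noteq> 0"
      by (rule AE_lborel_inner_neq) (auto simp: Basis_vec_def)
    then show "AE \<xi> in lborel. norm (norm \<xi> powr (- s) * cauchy_weight \<xi>) \<le>
      norm (\<bar>(\<xi>::real^'n) $ j\<bar> powr (- s) * cauchy_weight \<xi>)"
    proof eventually_elim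
      case (elim \<xi>)
      then have "norm \<xi> powr (- s) \<le> \<bar>\<xi> $ j\<bar> powr (- s)"
        using s component_le_norm_cart[of \<xi> j] by (intro powr_mono2') (auto simp: inner_axis)
      then show ?case
        by (simp add: abs_mult abs_of_pos[OF cauchy_weight_pos] less_imp_le[OF cauchy_weight_pos] mult_right_mono)
    qed
  qed (use integrable_cauchy_weight in measurable)
qed

text \<open>The test function is a product of tents: it is nonnegative and compactly supported, and
  its transform decays fast enough to be integrable against \<open>|\<xi>| powr (- s)\<close>.\<close>

lemma multiplier_norm_lower_bound:
  fixes m :: "real^'n::finite \<Rightarrow> complex"
  assumes m: "continuous_on UNIV m" and s: "0 < s" "s < 1"
    and norm_m: "\<And>\<xi>. norm (m \<xi>) = (2 * pi * norm \<xi>) powr s"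
  obtains K where "0 < K"
    "\<And>r x0 v. 0 < r \<Longrightarrow> v \<in> schwartz \<Longrightarrow> (\<And>x. (\<forall>i. \<bar>x $ i - x0 $ i\<bar> \<le> r) \<Longrightarrow> 1 \<le> v x) \<Longrightarrow>
      ennreal (r powr (real CARD('n) - s)) \<le> ennreal K * L1_norm (fourier_multiplier m v)"
proof -
  let ?n = "CARD('n)"
  \<comment> \<open>The majorant of \<theta> for r = 1. The case of general r is a dilate of it, so
    a single constant serves all cubes.\<close>
  define W :: "real^'n \<Rightarrow> real" where
    "W \<xi> = (2 ^ ?n * (2 * pi) powr (- s)) * (norm \<xi> powr (- s) * cauchy_weight \<xi>)" for \<xi>
  have W: "integrable lborel W"
    unfolding W_def by (intro integrable_mult_right integrable_riesz_cauchy_weight s)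
  have W_nn: "0 \<le> W \<xi>" for \<xi>
    unfolding W_def using cauchy_weight_pos[of \<xi>] by simp
  \<comment> \<open>The summand 1 makes \<open>K\<close> positive without a proof that the integral
    is.\<close>
  define K where "K = (LINT \<xi>|lborel. W \<xi>) + 1"
  have K: "0 < K" unfolding K_def using W_nn by (intro add_nonneg_pos integral_nonneg) auto
  show ?thesis
  proof (rule that[OF K])
    fix r :: real and x0 :: "real^'n" and v :: "real^'n \<Rightarrow> real"
    assume r: "0 < r" and v: "v \<in> schwartz" and v_ge: "\<And>x. (\<forall>i. \<bar>x $ i - x0 $ i\<bar> \<le> r) \<Longrightarrow> 1 \<le> v x"
    define T where "T \<eta> = (LINT t|lborel. of_real (tent t) * cis (- (2 * pi * (t * \<eta>))))" for \<eta>
    define \<phi> where "\<phi> x = (\<Prod>i\<in>UNIV. tent ((x $ i - x0 $ i) / r))" for x :: "real^'n"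
    have aff: "(t - x0 $ i) / r = - (x0 $ i / r) + (1 / r) *\<^sub>R t" for t i
      using r by (simp add: field_simps)
    have tent_int: "integrable lborel (\<lambda>t. tent ((t - x0 $ i) / r))" for i
      unfolding aff using r by (intro lborel_integrable_affine integrable_tent) auto
    then have tent_int': "integrable lborel (\<lambda>t. complex_of_real (tent ((t - x0 $ i) / r)))" for i by simp
    have \<phi>_int: "integrable lborel \<phi>"
      unfolding \<phi>_def[abs_def] by (rule integrable_prod_vec[where f = "\<lambda>i t. tent ((t - x0 $ i) / r)"]) (rule tent_int)
    have [measurable]: "\<phi> \<in> borel_measurable borel" using \<phi>_int by auto
    have \<phi>_nn: "0 \<le> \<phi> x" for x unfolding \<phi>_def by (intro prod_nonneg tent_nonneg ballI)
    have "(LINT t|lborel. tent ((t - x0 $ i) / r)) = r" for i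
      using r lborel_integral_affine[of "\<lambda>t. tent ((t - x0 $ i) / r)" r "x0 $ i"] integral_tent by simp
    then have \<phi>_integral: "(LINT x|lborel. \<phi> x) = r ^ ?n"
      unfolding \<phi>_def by (subst integral_prod_vec[where f = "\<lambda>i t. tent ((t - x0 $ i) / r)"]) (simp_all add: tent_int)
    have F\<phi>: "norm (fourier (\<lambda>x. of_real (\<phi> x)) \<xi>) \<le> r ^ ?n * (2 ^ ?n * cauchy_weight (r *\<^sub>R \<xi>))" for \<xi>
    proof -
      have one: "norm (LINT t|lborel. of_real (tent ((t - x0 $ i) / r)) * cis (- (2 * pi * (t * \<xi> $ i)))) \<le>
          r * (2 * inverse (1 + (r * \<xi> $ i)\<^sup>2))" for i
      proof -
        have "(LINT t|lborel. of_real (tent ((t - x0 $ i) / r)) * cis (- (2 * pi * (t * \<xi> $ i)))) =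
          r *\<^sub>R (LINT t|lborel. of_real (tent ((x0 $ i + r *\<^sub>R t - x0 $ i) / r)) * cis (- (2 * pi * ((x0 $ i + r *\<^sub>R t) * \<xi> $ i))))"
          using r lborel_integral_affine[of "\<lambda>t. of_real (tent ((t - x0 $ i) / r)) * cis (- (2 * pi * (t * \<xi> $ i)))" r "x0 $ i"] by simp
        also have "(\<lambda>t. of_real (tent ((x0 $ i + r *\<^sub>R t - x0 $ i) / r)) * cis (- (2 * pi * ((x0 $ i + r *\<^sub>R t) * \<xi> $ i)))) =
          (\<lambda>t. cis (- (2 * pi * (x0 $ i * \<xi> $ i))) * (of_real (tent t) * cis (- (2 * pi * (t * (r * \<xi> $ i))))))"
          using r by (auto simp: fun_eq_iff cis_mult mult.left_commute[of "cis _"] algebra_simps)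
        finally show ?thesis
          using fourier_tent_le[of "r * \<xi> $ i"] r by (simp add: norm_mult)
      qed
      have "norm (fourier (\<lambda>x. of_real (\<phi> x)) \<xi>) \<le> (\<Prod>i\<in>(UNIV::'n set). r * (2 * inverse (1 + (r * \<xi> $ i)\<^sup>2)))"
        unfolding \<phi>_def of_real_prod
        by (subst fourier_prod_vec[where f = "\<lambda>i t. complex_of_real (tent ((t - x0 $ i) / r))"])
           (use one in \<open>auto simp: tent_int' prod_norm[symmetric] intro!: prod_mono\<close>)
      also have "\<dots> = r ^ ?n * (2 ^ ?n * cauchy_weight (r *\<^sub>R \<xi>))"
        by (simp add: cauchy_weight_def prod.distrib)
      finally show ?thesis .
    qed
    define \<theta> where "\<theta> \<xi> = fourier (\<lambda>x. of_real (\<phi> x)) (- \<xi>) / m \<xi>" for \<xi>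
    have [measurable]: "m \<in> borel_measurable borel" using m by (rule borel_measurable_continuous_onI)
    have [measurable]: "\<theta> \<in> borel_measurable borel" unfolding \<theta>_def[abs_def] by measurable
    \<comment> \<open>The mass of \<phi> contributes r^n and the homogeneity of the symbol r^s; the
      dilation in the integral then cancels r^n, which leaves \<open>r powr s * K\<close> as the
      bound for the potential.\<close>
    have \<theta>_le: "norm (\<theta> \<xi>) \<le> r powr (real ?n + s) * W (0 + r *\<^sub>R \<xi>)" for \<xi>
    proof -
      have "norm (\<theta> \<xi>) \<le> r ^ ?n * (2 ^ ?n * cauchy_weight (r *\<^sub>R \<xi>)) * (2 * pi * norm \<xi>) powr (- s)"
      proof -
        have "cauchy_weight (r *\<^sub>R (- \<xi>)) = cauchy_weight (r *\<^sub>R \<xi>)" by (simp add: cauchy_weight_def)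
        with F\<phi>[of "- \<xi>"] have "norm (fourier (\<lambda>x. of_real (\<phi> x)) (- \<xi>)) \<le> r ^ ?n * (2 ^ ?n * cauchy_weight (r *\<^sub>R \<xi>))"
          by simp
        then show ?thesis
          unfolding \<theta>_def norm_divide norm_m unfolding powr_minus divide_inverse by (intro mult_right_mono) auto
      qed
      also have "\<dots> = r powr (real ?n + s) * W (0 + r *\<^sub>R \<xi>)"
        using r by (simp add: W_def powr_mult powr_add powr_realpow powr_minus field_simps)
      finally show ?thesis .
    qed
    have W': "integrable lborel (\<lambda>\<xi>. W (0 + r *\<^sub>R \<xi>))"
      using r by (intro lborel_integrable_affine W) auto
    have \<theta>: "integrable lborel \<theta>"
      by (rule Bochner_Integration.integrable_bound[OF integrable_mult_right[OF W', of "r powr (real ?n + s)"]])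
         (use \<theta>_le W_nn in \<open>auto simp: abs_mult\<close>)
    have "(LINT \<xi>|lborel. norm (\<theta> \<xi>)) \<le> (LINT \<xi>|lborel. r powr (real ?n + s) * W (0 + r *\<^sub>R \<xi>))"
      using \<theta> W' \<theta>_le by (intro integral_mono integrable_mult_right integrable_norm) auto
    also have "\<dots> = r powr s * (r ^ ?n *\<^sub>R (LINT \<xi>|lborel. W (0 + r *\<^sub>R \<xi>)))"
      using r by (simp add: powr_add powr_realpow)
    also have "r ^ ?n *\<^sub>R (LINT \<xi>|lborel. W (0 + r *\<^sub>R \<xi>)) = (LINT \<xi>|lborel. W \<xi>)"
      using r W lborel_integral_affine[of W r 0] by simp
    also have "r powr s * (LINT \<xi>|lborel. W \<xi>) \<le> r powr s * K"
      by (intro mult_left_mono) (auto simp: K_def)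
    finally have \<theta>_norm: "(LINT \<xi>|lborel. norm (\<theta> \<xi>)) \<le> r powr s * K" .
    have \<theta>_eq: "AE \<xi> in lborel. m \<xi> * \<theta> \<xi> = fourier (\<lambda>x. of_real (\<phi> x)) (- \<xi>)"
      using AE_lborel_singleton[of "0::real^'n"]
    proof eventually_elim
      case (elim \<xi>)
      then have "norm (m \<xi>) \<noteq> 0" unfolding norm_m by simp
      then show ?case by (simp add: \<theta>_def)
    qed
    show "ennreal (r powr (real ?n - s)) \<le> ennreal K * L1_norm (fourier_multiplier m v)"
    proof (cases "L1_norm (fourier_multiplier m v) = \<infinity>")
      case True
      then show ?thesis using K by (simp add: ennreal_mult_top)
    next
      case False
      obtain B where B: "\<bar>v x\<bar> \<le> B" for x
        using schwartz_bounded[OF v, of 0] unfolding bounded_iff by auto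
      have [measurable]: "v \<in> borel_measurable borel" by (rule borel_measurable_schwartz[OF v])
      have v\<phi>: "integrable lborel (\<lambda>x. v x * \<phi> x)"
      proof (rule Bochner_Integration.integrable_bound[OF integrable_mult_right[OF \<phi>_int, of B]])
        show "AE x in lborel. norm (v x * \<phi> x) \<le> norm (B * \<phi> x)"
          using B \<phi>_nn by (intro AE_I2) (auto simp: abs_mult intro!: mult_right_mono order_trans[OF B])
      qed auto
      have "\<phi> x \<le> v x * \<phi> x" for x
      proof (cases "\<forall>i. \<bar>x $ i - x0 $ i\<bar> \<le> r")
        case True
        then show ?thesis using mult_right_mono[OF v_ge \<phi>_nn, of x x] by simp
      next
        case False
        then obtain i where "r < \<bar>x $ i - x0 $ i\<bar>" by (auto simp: not_le)
        then have "tent ((x $ i - x0 $ i) / r) = 0" using r by (intro tent_eq_0) (simp add: field_simps)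
        then have "\<phi> x = 0" unfolding \<phi>_def by (subst prod_zero_iff) auto
        then show ?thesis by simp
      qed
      \<comment> \<open>On the support of \<phi> the competitor is at least 1, so the pairing is at
        least the mass of \<phi>. Dividing by r^s produces the exponent n - s.\<close>
      then have "r ^ ?n \<le> (LINT x|lborel. v x * \<phi> x)"
        unfolding \<phi>_integral[symmetric] by (intro integral_mono \<phi>_int v\<phi>)
      also have "\<dots> \<le> norm (LINT x|lborel. complex_of_real (v x) * of_real (\<phi> x))"
        unfolding of_real_mult[symmetric] by (subst integral_complex_of_real) simp
      also have "\<dots> \<le> enn2real (L1_norm (fourier_multiplier m v)) * (LINT \<xi>|lborel. norm (\<theta> \<xi>))"
        using False \<phi>_int
        by (intro multiplier_duality[OF v m s _ _ \<theta> \<theta>_eq]) (auto simp: norm_m less_top)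
      also have "\<dots> \<le> enn2real (L1_norm (fourier_multiplier m v)) * (r powr s * K)"
        by (intro mult_left_mono \<theta>_norm) auto
      finally have "r ^ ?n \<le> r powr s * (K * enn2real (L1_norm (fourier_multiplier m v)))" by (simp add: mult_ac)
      then have "r powr (real ?n - s) \<le> K * enn2real (L1_norm (fourier_multiplier m v))"
        using r by (simp add: powr_diff powr_realpow divide_le_eq mult_ac)
      then have "ennreal (r powr (real ?n - s)) \<le> ennreal (K * enn2real (L1_norm (fourier_multiplier m v)))"
        by (rule ennreal_leI)
      also have "\<dots> = ennreal K * L1_norm (fourier_multiplier m v)"
        using False K by (simp add: ennreal_mult less_top)
      finally show ?thesis .
    qed
  qed
qed

section \<open>Superpositions of Gaussians\<close>

text \<open>For negative \<open>b + 1\<close>, integration over all \<open>\<tau> > 0\<close> would give a multiple of \<open>norm x powr (2 * b + 2)\<close>;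
  the truncation makes it a Schwartz function.\<close>

definition gauss_mix :: "real \<Rightarrow> real \<Rightarrow> real^'n::finite \<Rightarrow> real" where
  "gauss_mix A b x = (LINT \<tau>|lborel. indicator {A..1} \<tau> * (\<tau> powr b * gauss \<tau> x))"

context
  fixes A :: real
  assumes A: "0 < A" "A \<le> 1"
begin

lemma gauss_mix_integrand:
  "integrable lborel (\<lambda>\<tau>. indicator {A..1} \<tau> * (\<tau> powr b * exp (- (pi * r / \<tau>))))"
proof -
  have "continuous_on {A..1} (\<lambda>\<tau>. \<tau> powr b * exp (- (pi * r / \<tau>)))"
    using A by (intro continuous_intros) auto
  from borel_integrable_compact[OF _ this] show ?thesis by simp
qed

text \<open>The gauge integral is the form in which \<open>leibniz_rule_field_derivative\<close>
  differentiates under the integral sign.\<close>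

lemma gauss_mix_eq_integral:
  "gauss_mix A b x = integral {A..1} (\<lambda>\<tau>. \<tau> powr b * exp (- (pi * (norm x)\<^sup>2 / \<tau>)))"
proof -
  have "set_integrable lborel {A..1} (\<lambda>\<tau>. \<tau> powr b * exp (- (pi * (norm x)\<^sup>2 / \<tau>)))"
    using gauss_mix_integrand[of b "(norm x)\<^sup>2"] unfolding set_integrable_def by simp
  from set_borel_integral_eq_integral(2)[OF this] show ?thesis
    unfolding gauss_mix_def gauss_def set_lebesgue_integral_def by simp
qed

lemma gauss_mix_nonneg: "0 \<le> gauss_mix A b x"
  unfolding gauss_mix_def by (intro Bochner_Integration.integral_nonneg) (auto simp: less_imp_le[OF gauss_pos])

text \<open>As a function of \<open>r = x \<bullet> x\<close> the integrand is smooth even at the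
  origin, and differentiating it in r brings down a factor \<open>- pi / \<tau>\<close>, which
  lowers \<open>b\<close> by one. The family is thus closed under differentiation up to coordinate
  factors.\<close>

lemma gauss_mix_has_derivative:
  fixes x :: "real^'n::finite"
  shows "(gauss_mix A b has_derivative (\<lambda>h. - (2 * pi) * gauss_mix A (b - 1) x * (x \<bullet> h))) (at x)"
proof -
  define w where "w b r = integral (cbox A 1) (\<lambda>\<tau>. \<tau> powr b * exp (- (pi * r / \<tau>)))" for b r :: real
  have "((\<lambda>r. integral (cbox A 1) (\<lambda>\<tau>. \<tau> powr b * exp (- (pi * r / \<tau>)))) has_real_derivative
      integral (cbox A 1) (\<lambda>\<tau>. - pi * (\<tau> powr (b - 1) * exp (- (pi * r / \<tau>))))) (at r within UNIV)" for r
  proof (rule leibniz_rule_field_derivative)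
    fix r \<tau> :: real assume "\<tau> \<in> cbox A 1"
    then show "((\<lambda>r. \<tau> powr b * exp (- (pi * r / \<tau>))) has_real_derivative - pi * (\<tau> powr (b - 1) * exp (- (pi * r / \<tau>)))) (at r within UNIV)"
      using A by (auto intro!: derivative_eq_intros simp: powr_diff)
  next
    show "(\<lambda>\<tau>. \<tau> powr b * exp (- (pi * r / \<tau>))) integrable_on cbox A 1" for r
      using A by (intro integrable_continuous continuous_intros) auto
  next
    show "continuous_on (UNIV \<times> cbox A 1) (\<lambda>(r, \<tau>). - pi * (\<tau> powr (b - 1) * exp (- (pi * r / \<tau>))))"
      using A unfolding case_prod_beta by (intro continuous_intros) auto
  qed auto
  then have w: "(w b has_real_derivative - pi * w (b - 1) r) (at r)" for r
    unfolding w_def by simp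
  have "((\<lambda>x. x \<bullet> x) has_derivative (\<lambda>h. x \<bullet> h + h \<bullet> x)) (at x)"
    by (auto intro!: derivative_eq_intros)
  from DERIV_compose_FDERIV[OF w this]
  have "((\<lambda>x. w b (x \<bullet> x)) has_derivative (\<lambda>h. (x \<bullet> h + h \<bullet> x) * (- pi * w (b - 1) (x \<bullet> x)))) (at x)" .
  moreover have "gauss_mix A b = (\<lambda>x::real^'n. w b (x \<bullet> x))" for b
    unfolding fun_eq_iff gauss_mix_eq_integral w_def power2_norm_eq_inner by simp
  ultimately show ?thesis
    by (simp add: inner_commute mult_ac)
qed

text \<open>Polynomials times mixtures with arbitrary exponents. The class is closed under partial
  derivatives and all its members decay rapidly, so Schwartz membership follows without formulas for
  iterated derivatives.\<close>

inductive gauss_mix_algebra :: "(real^'n::finite \<Rightarrow> real) \<Rightarrow> bool" where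
  base: "gauss_mix_algebra (gauss_mix A b)"
| coord: "gauss_mix_algebra f \<Longrightarrow> gauss_mix_algebra (\<lambda>x. x $ i * f x)"
| cmult: "gauss_mix_algebra f \<Longrightarrow> gauss_mix_algebra (\<lambda>x. c * f x)"
| add: "gauss_mix_algebra f \<Longrightarrow> gauss_mix_algebra g \<Longrightarrow> gauss_mix_algebra (\<lambda>x. f x + g x)"

lemma gauss_mix_algebra_partial:
  fixes f :: "real^'n::finite \<Rightarrow> real"
  assumes "gauss_mix_algebra f"
  shows "(\<forall>x. f differentiable (at x)) \<and> gauss_mix_algebra (partial j f)"
  using assms
proof induction
  case (base b)
  have "partial j (gauss_mix A b) = (\<lambda>x. - (2 * pi) * (x $ j * gauss_mix A (b - 1) x))"
    using partial_eqI[OF gauss_mix_has_derivative] by (auto simp: fun_eq_iff inner_axis mult_ac)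
  moreover have "gauss_mix_algebra (\<lambda>x::real^'n. - (2 * pi) * (x $ j * gauss_mix A (b - 1) x))"
    by (intro gauss_mix_algebra.intros)
  ultimately show ?case
    using gauss_mix_has_derivative by (auto simp: differentiable_def)
next
  case (coord f i)
  have f: "(f has_derivative frechet_derivative f (at x)) (at x)" for x
    using coord.IH frechet_derivative_works by blast
  have D: "((\<lambda>x. x $ i * f x) has_derivative (\<lambda>h. x $ i * frechet_derivative f (at x) h + h $ i * f x)) (at x)" for x
    by (intro has_derivative_mult f bounded_linear.has_derivative[OF bounded_linear_vec_nth has_derivative_ident])
  have "partial j (\<lambda>x. x $ i * f x) = (\<lambda>x. x $ i * partial j f x + axis j 1 $ i * f x)"
    using partial_eqI[OF D] by (simp add: fun_eq_iff partial_def)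
  moreover have "gauss_mix_algebra (\<lambda>x. x $ i * partial j f x + axis j 1 $ i * f x)"
    using coord by (intro gauss_mix_algebra.intros) auto
  ultimately show ?case using D by (auto simp: differentiable_def)
next
  case (cmult f c)
  then have f: "\<And>x. f differentiable (at x)" by blast
  show ?case
    unfolding partial_cmult[OF f] using cmult f
    by (intro conjI allI differentiable_mult differentiable_const gauss_mix_algebra.intros) auto
next
  case (add f g)
  have f: "(f has_derivative frechet_derivative f (at x)) (at x)" for x
    using add.IH frechet_derivative_works by blast
  have g: "(g has_derivative frechet_derivative g (at x)) (at x)" for x
    using add.IH frechet_derivative_works by blast
  note D = has_derivative_add[OF f g]
  have "partial j (\<lambda>x. f x + g x) = (\<lambda>x. partial j f x + partial j g x)"
    using partial_eqI[OF D] by (simp add: fun_eq_iff partial_def)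
  moreover have "gauss_mix_algebra (\<lambda>x. partial j f x + partial j g x)"
    using add by (intro gauss_mix_algebra.intros) auto
  ultimately show ?case using D by (auto simp: differentiable_def)
qed

text \<open>Raise \<open>y / k \<le> exp (y / k)\<close> to the power \<open>k\<close>; for
  \<open>k = 0\<close> the right-hand side is \<open>0 ^ 0 = 1\<close>.\<close>

lemma power_exp_bound:
  fixes y :: real
  assumes "0 \<le> y"
  shows "y ^ k * exp (- y) \<le> real k ^ k"
proof (cases "k = 0")
  case False
  have "y \<le> real k * exp (y / real k)"
    using exp_ge_add_one_self[of "y / real k"] False by (simp add: field_simps)
  then have "y ^ k \<le> (real k * exp (y / real k)) ^ k"
    using assms by (intro power_mono)
  also have "\<dots> = real k ^ k * exp y"
    using False by (simp add: power_mult_distrib exp_of_nat_mult[symmetric])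
  finally show ?thesis by (simp add: exp_minus field_simps)
qed (use assms in simp)

text \<open>The exponent \<open>k\<close> varies in the induction because a coordinate factor costs
  one more power of the norm.\<close>

lemma gauss_mix_algebra_bounded:
  fixes f :: "real^'n::finite \<Rightarrow> real"
  assumes "gauss_mix_algebra f"
  shows "\<exists>B. \<forall>x. norm x ^ k * \<bar>f x\<bar> \<le> B"
  using assms
proof (induction arbitrary: k)
  case (base b)
  \<comment> \<open>Uniform in \<tau>: since \<tau> is at most 1, hence less than \<open>pi\<close>,
    every Gaussian of the mixture lies below \<open>exp (- (norm x)\<^sup>2)\<close>.\<close>
  have bound: "norm x ^ k * gauss \<tau> x \<le> 1 + real k ^ k" if "\<tau> \<in> {A..1}" for \<tau> and x :: "real^'n"
  proof -
    have "(norm x)\<^sup>2 * \<tau> \<le> (norm x)\<^sup>2 * pi"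
      using that pi_gt3 by (intro mult_left_mono) auto
    then have "(norm x)\<^sup>2 \<le> pi * (norm x)\<^sup>2 / \<tau>"
      using that A by (simp add: pos_le_divide_eq mult.commute)
    then have g: "gauss \<tau> x \<le> exp (- (norm x)\<^sup>2)" by (simp add: gauss_def)
    have n: "norm x ^ k \<le> 1 + ((norm x)\<^sup>2) ^ k"
    proof (cases "norm x \<le> 1")
      case True
      then have "norm x ^ k \<le> 1" by (intro power_le_one) auto
      then show ?thesis by (smt (verit) zero_le_power zero_le_power2)
    next
      case False
      then have "norm x ^ k \<le> ((norm x)\<^sup>2) ^ k" by (intro power_mono self_le_power) auto
      then show ?thesis by simp
    qed
    have "norm x ^ k * gauss \<tau> x \<le> (1 + ((norm x)\<^sup>2) ^ k) * exp (- (norm x)\<^sup>2)"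
      by (intro mult_mono g n) (auto simp: less_imp_le[OF gauss_pos])
    also have "\<dots> = exp (- (norm x)\<^sup>2) + ((norm x)\<^sup>2) ^ k * exp (- (norm x)\<^sup>2)" by (simp add: algebra_simps)
    also have "\<dots> \<le> 1 + real k ^ k" by (intro add_mono power_exp_bound) auto
    finally show ?thesis .
  qed
  have int: "integrable lborel (\<lambda>\<tau>. indicator {A..1} \<tau> * \<tau> powr b)"
    using gauss_mix_integrand[of b 0] by simp
  show ?case
  proof (intro exI allI)
    fix x :: "real^'n"
    have "norm x ^ k * \<bar>gauss_mix A b x\<bar> = (LINT \<tau>|lborel. norm x ^ k * (indicator {A..1} \<tau> * (\<tau> powr b * gauss \<tau> x)))"
      using gauss_mix_nonneg[of b x] by (simp add: gauss_mix_def)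
    also have "\<dots> \<le> (LINT \<tau>|lborel. (indicator {A..1} \<tau> * \<tau> powr b) * (1 + real k ^ k))"
    proof (rule integral_mono)
      show "integrable lborel (\<lambda>\<tau>. norm x ^ k * (indicator {A..1} \<tau> * (\<tau> powr b * gauss \<tau> x)))"
        unfolding gauss_def by (intro integrable_mult_right gauss_mix_integrand)
      show "norm x ^ k * (indicator {A..1} \<tau> * (\<tau> powr b * gauss \<tau> x)) \<le> (indicator {A..1} \<tau> * \<tau> powr b) * (1 + real k ^ k)" for \<tau>
        using mult_left_mono[OF bound[of \<tau> x], of "\<tau> powr b"] by (auto simp: indicator_def mult_ac)
    qed (use int in auto)
    finally show "norm x ^ k * \<bar>gauss_mix A b x\<bar> \<le> (LINT \<tau>|lborel. (indicator {A..1} \<tau> * \<tau> powr b) * (1 + real k ^ k))" .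
  qed
next
  case (coord f i)
  obtain B where B: "norm x ^ Suc k * \<bar>f x\<bar> \<le> B" for x using coord.IH by blast
  have "norm x ^ k * \<bar>x $ i * f x\<bar> \<le> B" for x
  proof -
    have "norm x ^ k * \<bar>x $ i * f x\<bar> \<le> norm x ^ k * (norm x * \<bar>f x\<bar>)"
      unfolding abs_mult by (intro mult_left_mono mult_right_mono component_le_norm_cart) auto
    also have "\<dots> = norm x ^ Suc k * \<bar>f x\<bar>" by simp
    finally show ?thesis using B[of x] by linarith
  qed
  then show ?case by blast
next
  case (cmult f c)
  obtain B where B: "norm x ^ k * \<bar>f x\<bar> \<le> B" for x using cmult.IH by blast
  have "norm x ^ k * \<bar>c * f x\<bar> \<le> \<bar>c\<bar> * B" for x
    using mult_left_mono[OF B, of "\<bar>c\<bar>" x] by (simp add: abs_mult mult_ac)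
  then show ?case by blast
next
  case (add f g)
  obtain B where B: "norm x ^ k * \<bar>f x\<bar> \<le> B" for x using add.IH(1) by blast
  obtain B' where B': "norm x ^ k * \<bar>g x\<bar> \<le> B'" for x using add.IH(2) by blast
  have "norm x ^ k * \<bar>f x + g x\<bar> \<le> B + B'" for x
  proof -
    have "norm x ^ k * \<bar>f x + g x\<bar> \<le> norm x ^ k * (\<bar>f x\<bar> + \<bar>g x\<bar>)"
      by (intro mult_left_mono) auto
    then show ?thesis using B[of x] B'[of x] by (simp add: distrib_left)
  qed
  then show ?case by blast
qed

lemma gauss_mix_algebra_schwartz:
  assumes "gauss_mix_algebra f"
  shows "f \<in> schwartz"
proof -
  have alg: "gauss_mix_algebra (iterated_partial js f)" for js
    by (induction js) (use assms gauss_mix_algebra_partial in auto)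
  show ?thesis
    unfolding schwartz_def bounded_iff
    using gauss_mix_algebra_partial[OF alg] gauss_mix_algebra_bounded[OF alg]
    by (simp add: abs_mult)
qed

lemma schwartz_gauss_mix: "gauss_mix A b \<in> schwartz"
  by (intro gauss_mix_algebra_schwartz gauss_mix_algebra.base)

lemma partial_gauss_mix:
  "partial j (gauss_mix A b) x = - (2 * pi) * (x $ j * gauss_mix A (b - 1) x)"
  using partial_eqI[OF gauss_mix_has_derivative] by (simp add: inner_axis mult_ac)

text \<open>The Gaussians transform one by one. As \<tau> is at most 1, \<open>gauss 1\<close>
  dominates all of them, which justifies the interchange of integrals.\<close>

lemma fourier_gauss_mix:
  fixes \<xi> :: "real^'n::finite"
  shows "fourier (\<lambda>x. of_real (gauss_mix A b x)) \<xi> =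
    of_real (LINT \<tau>|lborel. indicator {A..1} \<tau> * (\<tau> powr (b + real CARD('n) / 2) * gauss (1 / \<tau>) \<xi>))"
proof -
  define h where "h x \<tau> = complex_of_real (indicator {A..1} \<tau> * (\<tau> powr b * exp (- (pi * (norm x)\<^sup>2 / \<tau>)))) *
      cis (- (2 * pi * (x \<bullet> \<xi>)))" for x :: "real^'n" and \<tau> :: real
  have int: "integrable lborel (\<lambda>\<tau>. indicator {A..1} \<tau> * \<tau> powr b)"
    using gauss_mix_integrand[of b 0] by simp
  have "case_prod h \<in> borel_measurable (lborel \<Otimes>\<^sub>M lborel)"
    unfolding h_def by measurable
  then have "integrable (lborel \<Otimes>\<^sub>M lborel) (case_prod h)"
  proof (rule integrable_lborel_pairI[OF _ integrable_gauss[of 1] int])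
    fix x :: "real^'n" and \<tau> :: real
    have "indicator {A..1} \<tau> * (\<tau> powr b * exp (- (pi * (norm x)\<^sup>2 / \<tau>))) \<le> gauss 1 x * (indicator {A..1} \<tau> * \<tau> powr b)"
    proof (cases "\<tau> \<in> {A..1}")
      case True
      then have "pi * (norm x)\<^sup>2 * \<tau> \<le> pi * (norm x)\<^sup>2 * 1" by (intro mult_left_mono) auto
      then have "pi * (norm x)\<^sup>2 \<le> pi * (norm x)\<^sup>2 / \<tau>"
        using True A by (simp add: pos_le_divide_eq)
      then show ?thesis by (simp add: gauss_def mult_ac mult_left_mono)
    qed simp
    then show "norm (case (x, \<tau>) of (x, \<tau>) \<Rightarrow> h x \<tau>) \<le> norm (gauss 1 x) * norm (indicator {A..1} \<tau> * \<tau> powr b)"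
      by (simp add: h_def norm_mult abs_mult abs_of_pos[OF gauss_pos])
  qed simp
  note fubini = lborel_pair.Fubini_integral[OF this]
  have "fourier (\<lambda>x. of_real (gauss_mix A b x)) \<xi> = (LINT x|lborel. LINT \<tau>|lborel. h x \<tau>)"
    unfolding fourier_eq_cis h_def gauss_mix_def gauss_def integral_complex_of_real[symmetric] integral_mult_left_zero ..
  also have "\<dots> = (LINT \<tau>|lborel. LINT x|lborel. h x \<tau>)" by (rule fubini[symmetric])
  also have "\<dots> = (LINT \<tau>|lborel. of_real (indicator {A..1} \<tau> * (\<tau> powr (b + real CARD('n) / 2) * gauss (1 / \<tau>) \<xi>)))"
  proof (rule Bochner_Integration.integral_cong[OF refl])
    fix \<tau> :: real
    show "(LINT x|lborel. h x \<tau>) = of_real (indicator {A..1} \<tau> * (\<tau> powr (b + real CARD('n) / 2) * gauss (1 / \<tau>) \<xi>))"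
    proof (cases "\<tau> \<in> {A..1}")
      case True
      then have \<tau>: "0 < \<tau>" using A by auto
      have "(LINT x|lborel. h x \<tau>) = (LINT x|lborel. of_real (\<tau> powr b) * (of_real (gauss \<tau> x) * cis (- (2 * pi * (x \<bullet> \<xi>)))))"
        using True by (simp add: h_def gauss_def mult_ac)
      also have "\<dots> = of_real (\<tau> powr b) * fourier (\<lambda>x. of_real (gauss \<tau> x)) \<xi>"
        by (simp add: fourier_eq_cis)
      finally show ?thesis
        using True \<tau> by (simp add: fourier_gauss powr_add)
    qed (simp add: h_def)
  qed
  finally show ?thesis by (simp only: integral_complex_of_real)
qed

text \<open>Only the widths between \<open>r\<^sup>2\<close> and \<open>2 * r\<^sup>2\<close> are
  kept, a window inside the truncation range. There each Gaussian is at least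
  \<open>exp (- pi)\<close> on the ball of radius \<open>r\<close>, the power is at least
  \<open>(2 * r\<^sup>2) powr b\<close>, and the window has length \<open>r\<^sup>2\<close>.\<close>

lemma gauss_mix_lower_bound:
  assumes r: "A \<le> r\<^sup>2" "2 * r\<^sup>2 \<le> 1" "0 < r" and b: "b \<le> 0" and x: "norm x \<le> r"
  shows "exp (- pi) * 2 powr b * r powr (2 * b + 2) \<le> gauss_mix A b x"
proof -
  have "exp (- pi) * 2 powr b * r powr (2 * b + 2) = r\<^sup>2 * ((2 * r\<^sup>2) powr b * exp (- pi))"
  proof -
    have "r\<^sup>2 = r powr 2" using r(3) by simp
    then have "(r\<^sup>2) powr b = r powr (2 * b)" by (simp only: powr_powr)
    then show ?thesis using r(3) by (simp add: powr_add powr_mult)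
  qed
  also have "\<dots> = (LINT \<tau>|lborel. indicator {r\<^sup>2..2 * r\<^sup>2} \<tau> * ((2 * r\<^sup>2) powr b * exp (- pi)))"
    using r by simp
  also have "\<dots> \<le> gauss_mix A b x"
    unfolding gauss_mix_def
  proof (rule integral_mono)
    show "integrable lborel (\<lambda>\<tau>. indicator {A..1} \<tau> * (\<tau> powr b * gauss \<tau> x))"
      unfolding gauss_def by (rule gauss_mix_integrand)
    show "indicator {r\<^sup>2..2 * r\<^sup>2} \<tau> * ((2 * r\<^sup>2) powr b * exp (- pi)) \<le> indicator {A..1} \<tau> * (\<tau> powr b * gauss \<tau> x)" for \<tau>
    proof (cases "\<tau> \<in> {r\<^sup>2..2 * r\<^sup>2}")
      case True
      then have \<tau>: "\<tau> \<in> {A..1}" "0 < \<tau>" using r A by auto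
      have "(norm x)\<^sup>2 \<le> \<tau>" using x True power_mono[OF x, of 2] by auto
      then have "pi * (norm x)\<^sup>2 / \<tau> \<le> pi" using \<tau> by (simp add: divide_le_eq)
      then have "exp (- pi) \<le> gauss \<tau> x" by (simp add: gauss_def)
      moreover have "(2 * r\<^sup>2) powr b \<le> \<tau> powr b" using True \<tau> b by (intro powr_mono2') auto
      ultimately show ?thesis using True \<tau> by (auto intro!: mult_mono)
    qed (auto simp: less_imp_le[OF gauss_pos])
  qed simp
  finally show ?thesis .
qed

end

section \<open>An upper bound for multiplier norms\<close>

text \<open>The Gamma integral rescaled by \<open>pi * \<sigma>\<close>; it writes a negative power
  as a superposition of exponentials.\<close>

lemma
  fixes p \<sigma> :: real
  assumes p: "0 < p" "p < 1" and \<sigma>: "0 < \<sigma>"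
  shows integrable_gamma_laplace: "integrable lborel (\<lambda>w. indicator {0<..} w * (w powr (- p) * exp (- (pi * \<sigma> * w))))" (is ?A)
    and integral_gamma_laplace: "(LINT w|lborel. indicator {0<..} w * (w powr (- p) * exp (- (pi * \<sigma> * w)))) =
      Gamma (1 - p) * (pi * \<sigma>) powr (p - 1)" (is ?B)
proof -
  define g where "g t = indicator {0..} t * t powr (- p) / exp t" for t :: real
  have [measurable]: "g \<in> borel_measurable borel" unfolding g_def[abs_def] by measurable
  have g: "has_bochner_integral lborel g (Gamma (1 - p))"
    using Gamma_conv_nn_integral_real[of "1 - p"] p
    by (intro has_bochner_integral_nn_integral) (auto simp: g_def Gamma_real_pos less_imp_le)
  define c where "c = pi * \<sigma>"
  have c: "0 < c" using \<sigma> by (simp add: c_def)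
  have gc: "g (0 + c *\<^sub>R w) = c powr (- p) * (indicator {0<..} w * (w powr (- p) * exp (- (pi * \<sigma> * w))))" for w
  proof (cases "0 < w")
    case True
    then show ?thesis using c by (simp add: g_def powr_mult exp_minus divide_inverse c_def[symmetric])
  next
    case False
    then have "w = 0 \<or> c * w < 0" using c by (auto simp: mult_pos_neg not_less order_le_less)
    then show ?thesis using False by (auto simp: g_def)
  qed
  have "integrable lborel (\<lambda>w. g (0 + c *\<^sub>R w))"
    using g c by (intro lborel_integrable_affine) (auto simp: has_bochner_integral_iff)
  from integrable_mult_right[OF this, of "c powr p"] show ?A
    unfolding gc using c by (simp add: powr_minus)
  have "Gamma (1 - p) = c * (LINT w|lborel. g (0 + c *\<^sub>R w))"
    using g c lborel_integral_affine[of g c 0] by (simp add: has_bochner_integral_iff)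
  also have "\<dots> = (c * c powr (- p)) * (LINT w|lborel. indicator {0<..} w * (w powr (- p) * exp (- (pi * \<sigma> * w))))"
    unfolding gc by simp
  finally show ?B
    unfolding c_def[symmetric] using c by (simp add: powr_diff powr_minus field_simps)
qed

text \<open>The mixing measure of the incomplete Gamma function: for p and r in the relevant range,
  \<open>mix_density p w * exp (- (pi * r * (1 + w)))\<close> integrates to \<Gamma>(p,
  \<open>pi * r\<close>) divided by \<open>pi powr p\<close>.\<close>

definition mix_density :: "real \<Rightarrow> real \<Rightarrow> real" where
  "mix_density p w = indicator {0<..} w * (w powr (- p) / (1 + w)) / (Gamma (1 - p) * pi powr p)"

lemma mix_density_nonneg: "p < 1 \<Longrightarrow> 0 \<le> mix_density p w"
  unfolding mix_density_def by (auto simp: indicator_def Gamma_real_pos less_imp_le)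

lemma borel_measurable_mix_density [measurable]: "mix_density p \<in> borel_measurable borel"
  unfolding mix_density_def[abs_def] by measurable

text \<open>The density behaves like \<open>w powr (- p)\<close> at 0, where \<open>p < 1\<close> is
  used, and like \<open>w powr (- p - 1)\<close> at infinity, where \<open>0 < p\<close> is
  used.\<close>

lemma integrable_mix_density:
  assumes p: "0 < p" "p < 1"
  shows "integrable lborel (mix_density p)"
proof -
  have "(\<lambda>t::real. t powr (- p)) absolutely_integrable_on {0..1}"
    using p by (intro nonnegative_absolutely_integrable_1 integrable_on_powr_from_0) auto
  then have i1: "integrable lborel (\<lambda>t::real. indicator {0..1} t *\<^sub>R t powr (- p))"
    unfolding set_integrable_def by (subst (asm) integrable_completion) auto
  have "(\<lambda>t::real. t powr (- p - 1)) integrable_on {1..}"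
    using has_integral_powr_to_inf[of "- p - 1" 1] p by (auto simp: integrable_on_def)
  then have "(\<lambda>t::real. t powr (- p - 1)) absolutely_integrable_on {1..}"
    by (intro nonnegative_absolutely_integrable_1) auto
  then have i2: "integrable lborel (\<lambda>t::real. indicator {1..} t *\<^sub>R t powr (- p - 1))"
    unfolding set_integrable_def by (subst (asm) integrable_completion) auto
  have "integrable lborel (\<lambda>w::real. indicator {0<..} w * (w powr (- p) / (1 + w)))"
  proof (rule Bochner_Integration.integrable_bound[OF Bochner_Integration.integrable_add[OF i1 i2]])
    show "AE w in lborel. norm (indicator {0<..} w * (w powr (- p) / (1 + w))) \<le>
      norm (indicator {0..1} w *\<^sub>R w powr (- p) + indicator {1..} w *\<^sub>R w powr (- p - 1))"
    proof (rule AE_I2)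
      fix w :: real
      have "indicator {0<..} w * (w powr (- p) / (1 + w)) \<le>
        indicator {0..1} w *\<^sub>R w powr (- p) + indicator {1..} w *\<^sub>R w powr (- p - 1)"
      proof (cases "w \<in> {0<..}")
        case True
        then have w: "0 < w" by simp
        show ?thesis
        proof (cases "w \<le> 1")
          case True
          have "w powr (- p) / (1 + w) \<le> w powr (- p)"
            using w by (simp add: divide_le_eq)
          then show ?thesis using w True by (auto simp: indicator_def)
        next
          case False
          have "w powr (- p) / (1 + w) \<le> w powr (- p) / w"
            using w by (intro divide_left_mono) auto
          then show ?thesis using w False by (simp add: powr_diff)
        qed
      qed auto
      moreover have "0 \<le> indicator {0<..} w * (w powr (- p) / (1 + w))" by (auto simp: indicator_def)
      ultimately show "norm (indicator {0<..} w * (w powr (- p) / (1 + w))) \<le>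
        norm (indicator {0..1} w *\<^sub>R w powr (- p) + indicator {1..} w *\<^sub>R w powr (- p - 1))"
        unfolding real_norm_def by linarith
    qed
  qed measurable
  then show ?thesis unfolding mix_density_def[abs_def] by (rule integrable_divide)
qed

text \<open>The function \<open>r powr p\<close> times the integral of \<open>\<tau> powr (p - 1) * exp (- (pi * \<tau> * r))\<close> over
  \<open>{A..1}\<close> is a difference of two dilates of one completely monotone function of \<open>r\<close>, hence a difference
  of two superpositions of Gaussians whose total mass does not depend on \<open>A\<close>.\<close>

lemma riesz_symbol_eq_gaussian_mixture:
  fixes \<xi> :: "real^'n::finite"
  assumes p: "0 < p" "p < 1" and A: "0 < A" "A \<le> 1"
  shows "norm \<xi> powr (2 * p) * (LINT \<tau>|lborel. indicator {A..1} \<tau> * (\<tau> powr (p - 1) * gauss (1 / \<tau>) \<xi>)) =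
    (LINT w|lborel. mix_density p w * (gauss (1 / (A * (1 + w))) \<xi> - gauss (1 / (1 + w)) \<xi>))"
proof (cases "\<xi> = 0")
  case True
  then show ?thesis by (simp add: gauss_def)
next
  case False
  define r where "r = (norm \<xi>)\<^sup>2"
  have r: "0 < r" using False by (simp add: r_def)
  have "0 < Gamma (1 - p)" using p by (intro Gamma_real_pos) simp
  then have G: "Gamma (1 - p) \<noteq> 0" by simp
  have gauss_r: "gauss (1 / t) \<xi> = exp (- (pi * r * t))" for t
    by (simp add: gauss_def r_def)
  \<comment> \<open>One kernel gives both sides: integration in \<open>w\<close> is a Gamma integral
    and produces the power of \<tau>; integration in \<tau> produces the difference of exponentials
    over \<open>pi * r * (1 + w)\<close>, the origin of the denominator in
    \<open>mix_density\<close>.\<close>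
  define h where "h \<tau> w = indicator {A..1} \<tau> * (indicator {0<..} w * (w powr (- p) * exp (- (pi * r * \<tau> * (1 + w)))))"
    for \<tau> w :: real
  have "case_prod h \<in> borel_measurable (lborel \<Otimes>\<^sub>M lborel)" unfolding h_def by measurable
  then have "integrable (lborel \<Otimes>\<^sub>M lborel) (case_prod h)"
  proof (rule integrable_lborel_pairI)
    show "integrable lborel (indicator {A..1} :: real \<Rightarrow> real)" using A by (intro integrable_real_indicator) auto
    show "integrable lborel (\<lambda>w. indicator {0<..} w * (w powr (- p) * exp (- (pi * (r * A) * w))))"
      using p r A by (intro integrable_gamma_laplace) auto
    fix \<tau> w :: real
    have "exp (- (pi * r * \<tau> * (1 + w))) \<le> exp (- (pi * (r * A) * w))" if "\<tau> \<in> {A..1}" "0 < w"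
    proof -
      have "A * w \<le> \<tau> * (1 + w)" using that A by (intro mult_mono) auto
      then have "(pi * r) * (A * w) \<le> (pi * r) * (\<tau> * (1 + w))" using r by (intro mult_left_mono) auto
      then show ?thesis by (simp add: mult_ac)
    qed
    then show "norm (case (\<tau>, w) of (\<tau>, w) \<Rightarrow> h \<tau> w) \<le> norm (indicator {A..1} \<tau> :: real) *
        norm (indicator {0<..} w * (w powr (- p) * exp (- (pi * (r * A) * w))))"
      by (auto simp: h_def indicator_def abs_mult intro!: mult_left_mono)
  qed
  note fubini = lborel_pair.Fubini_integral[OF this]
  have w_int: "(LINT w|lborel. h \<tau> w) = indicator {A..1} \<tau> * (\<tau> powr (p - 1) * gauss (1 / \<tau>) \<xi>) * (Gamma (1 - p) * (pi * r) powr (p - 1))" for \<tau>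
  proof (cases "\<tau> \<in> {A..1}")
    case True
    then have \<tau>: "0 < \<tau>" using A by auto
    have "(LINT w|lborel. h \<tau> w) = (LINT w|lborel. exp (- (pi * r * \<tau>)) * (indicator {0<..} w * (w powr (- p) * exp (- (pi * (r * \<tau>) * w)))))"
      using True by (intro Bochner_Integration.integral_cong) (auto simp: h_def algebra_simps exp_add[symmetric] exp_diff exp_minus field_simps)
    also have "\<dots> = exp (- (pi * r * \<tau>)) * (Gamma (1 - p) * (pi * (r * \<tau>)) powr (p - 1))"
      using integral_gamma_laplace[OF p, of "r * \<tau>"] r \<tau> by simp
    finally show ?thesis using True r \<tau> by (simp add: gauss_r powr_mult mult_ac)
  qed (simp add: h_def)
  have \<tau>_int: "(LINT \<tau>|lborel. h \<tau> w) = mix_density p w * (gauss (1 / (A * (1 + w))) \<xi> - gauss (1 / (1 + w)) \<xi>) * (Gamma (1 - p) * pi powr (p - 1) / r)" for w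
  proof (cases "0 < w")
    case True
    define a where "a = pi * r * (1 + w)"
    have a: "0 < a" using r True by (simp add: a_def)
    have "(LINT \<tau>|lborel. h \<tau> w) = (LINT \<tau>|lborel. w powr (- p) * (exp (- (a * \<tau>)) * indicator {A..1} \<tau>))"
      using True by (intro Bochner_Integration.integral_cong) (auto simp: h_def a_def mult_ac)
    also have "\<dots> = w powr (- p) * (LINT \<tau>|lborel. exp (- (a * \<tau>)) * indicator {A..1} \<tau>)" by simp
    also have "(LINT \<tau>|lborel. exp (- (a * \<tau>)) * indicator {A..1} \<tau>) = - exp (- (a * 1)) / a - - exp (- (a * A)) / a"
      using A a by (intro integral_FTC_Icc_real) (auto intro!: derivative_eq_intros continuous_intros)
    also have "\<dots> = (exp (- (a * A)) - exp (- a)) / a" by (simp add: diff_divide_distrib)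
    also have "exp (- (a * A)) = gauss (1 / (A * (1 + w))) \<xi>" by (simp add: gauss_r a_def mult_ac)
    also have "exp (- a) = gauss (1 / (1 + w)) \<xi>" by (simp add: gauss_r a_def mult_ac)
    finally show ?thesis
      using True r G by (simp add: mix_density_def a_def powr_diff)
  qed (simp add: h_def mix_density_def)
  have "(LINT w|lborel. LINT \<tau>|lborel. h \<tau> w) = (LINT \<tau>|lborel. LINT w|lborel. h \<tau> w)" by (rule fubini)
  then have "(LINT w|lborel. mix_density p w * (gauss (1 / (A * (1 + w))) \<xi> - gauss (1 / (1 + w)) \<xi>)) * (Gamma (1 - p) * pi powr (p - 1) / r)
      = (LINT \<tau>|lborel. indicator {A..1} \<tau> * (\<tau> powr (p - 1) * gauss (1 / \<tau>) \<xi>)) * (Gamma (1 - p) * (pi * r) powr (p - 1))"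
    unfolding w_int \<tau>_int by simp
  moreover have "Gamma (1 - p) * (pi * r) powr (p - 1) = r powr p * (Gamma (1 - p) * pi powr (p - 1) / r)"
    using r by (simp add: powr_mult powr_diff)
  moreover have "Gamma (1 - p) * pi powr (p - 1) / r \<noteq> 0"
    using r G by simp
  moreover have "norm \<xi> powr (2 * p) = r powr p"
  proof -
    have "r = norm \<xi> powr 2" using False by (simp add: r_def)
    then show ?thesis by (simp only: powr_powr)
  qed
  ultimately show ?thesis by (simp add: mult_ac)
qed

text \<open>A Bochner integral that does not exist is 0 by convention, so the bound covers that case
  as well.\<close>

lemma ennreal_norm_integral_le:
  fixes f :: "'a \<Rightarrow> 'b::{banach, second_countable_topology}"
  shows "ennreal (norm (integral\<^sup>L M f)) \<le> (\<integral>\<^sup>+x. norm (f x) \<partial>M)"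
  by (cases "integrable M f") (auto simp: integral_norm_bound_ennreal not_integrable_integral_eq)

lemma nn_integral_gauss_kernel:
  assumes "0 < t"
  shows "(\<integral>\<^sup>+x. ennreal (t powr (- (real CARD('n) / 2)) * gauss t (x::real^'n::finite)) \<partial>lborel) = 1"
proof -
  have "(\<integral>\<^sup>+x. ennreal (t powr (- (real CARD('n) / 2)) * gauss t (x::real^'n)) \<partial>lborel) =
    ennreal (LINT x|lborel. t powr (- (real CARD('n) / 2)) * gauss t (x::real^'n))"
    using assms by (intro nn_integral_eq_integral) (auto simp: integrable_gauss less_imp_le[OF gauss_pos])
  also have "(LINT x|lborel. t powr (- (real CARD('n) / 2)) * gauss t (x::real^'n)) = 1"
    using assms by (simp add: integral_gauss powr_minus)
  finally show ?thesis by simp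
qed

text \<open>By \<open>riesz_symbol_eq_gaussian_mixture\<close> the inverse transform is a mixture of
  differences of two Gaussian kernels of mass one. Each contributes at most its mass, whence the
  factor 2 and the independence of \<open>A\<close>.\<close>

lemma multiplier_norm_upper_bound:
  fixes u :: "real^'n::finite \<Rightarrow> real"
  assumes p: "0 < p" "p < 1" and A: "0 < A" "A \<le> 1"
    and symbol: "\<And>\<xi>. m \<xi> * fourier (\<lambda>x. of_real (u x)) \<xi> =
      c * of_real (norm \<xi> powr (2 * p) * (LINT \<tau>|lborel. indicator {A..1} \<tau> * (\<tau> powr (p - 1) * gauss (1 / \<tau>) \<xi>)))"
  shows "L1_norm (fourier_multiplier m u) \<le> ennreal (norm c * (2 * (LINT w|lborel. mix_density p w)))"
proof -
  \<comment> \<open>The Gaussian kernel of mass one, the inverse transform of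
    \<open>gauss (1 / t)\<close>.\<close>
  define P where "P t x = t powr (- (real CARD('n) / 2)) * gauss t x" for t and x :: "real^'n"
  have P_nn: "0 \<le> P t x" for t x by (simp add: P_def less_imp_le[OF gauss_pos])
  have [measurable]: "(\<lambda>z. P (f z) (g z)) \<in> borel_measurable M"
    if "f \<in> borel_measurable M" "g \<in> borel_measurable M" for M :: "'z measure" and f g
    using that unfolding P_def gauss_def by measurable
  have f_le: "ennreal (norm (fourier_multiplier m u x)) \<le>
      ennreal (norm c) * (\<integral>\<^sup>+w. ennreal (mix_density p w * (P (A * (1 + w)) x + P (1 + w) x)) \<partial>lborel)" for x
  proof -
    define H where "H \<xi> w = complex_of_real (mix_density p w * (gauss (1 / (A * (1 + w))) \<xi> - gauss (1 / (1 + w)) \<xi>)) *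
        cis (- (2 * pi * (\<xi> \<bullet> (- x))))" for \<xi> w
    have "case_prod H \<in> borel_measurable (lborel \<Otimes>\<^sub>M lborel)"
      unfolding H_def gauss_def by measurable
    then have "integrable (lborel \<Otimes>\<^sub>M lborel) (case_prod H)"
    proof (rule integrable_lborel_pairI[OF _ _ integrable_mix_density[OF p]])
      show "integrable lborel (gauss (1 / A) :: real^'n \<Rightarrow> real)" using A by (intro integrable_gauss) auto
      fix \<xi> :: "real^'n" and w :: real
      \<comment> \<open>This majorant depends on \<open>A\<close>, but it only serves to justify the
        interchange of integrals and does not enter the final bound.\<close>
      have D: "\<bar>gauss (1 / (A * (1 + w))) \<xi> - gauss (1 / (1 + w)) \<xi>\<bar> \<le> gauss (1 / A) \<xi>" if w: "0 < w"
      proof -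
        have mono: "gauss (1 / b) \<xi> \<le> gauss (1 / a) \<xi>" if "0 < a" "a \<le> b" for a b
          using that by (simp add: gauss_def mult_left_mono)
        have "gauss (1 / (A * (1 + w))) \<xi> \<le> gauss (1 / A) \<xi>" "gauss (1 / (1 + w)) \<xi> \<le> gauss (1 / A) \<xi>"
          using A w by (auto intro!: mono)
        then show ?thesis using gauss_pos[of _ \<xi>] by (smt (verit))
      qed
      show "norm (case (\<xi>, w) of (\<xi>, w) \<Rightarrow> H \<xi> w) \<le> norm (gauss (1 / A) \<xi>) * norm (mix_density p w)"
      proof (cases "0 < w")
        case True
        from mult_left_mono[OF D[OF this] abs_ge_zero[of "mix_density p w"]] show ?thesis
          by (simp add: H_def norm_mult abs_mult abs_of_pos[OF gauss_pos] mult.commute flip: of_real_diff)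
      qed (simp add: H_def mix_density_def)
    qed
    note fubini = lborel_pair.Fubini_integral[OF this]
    have H: "(LINT w|lborel. H \<xi> w) = of_real (LINT w|lborel. mix_density p w * (gauss (1 / (A * (1 + w))) \<xi> - gauss (1 / (1 + w)) \<xi>)) *
        cis (- (2 * pi * (\<xi> \<bullet> (- x))))" for \<xi>
      unfolding H_def integral_mult_left_zero integral_complex_of_real ..
    have "fourier_multiplier m u x = (LINT \<xi>|lborel. c * (LINT w|lborel. H \<xi> w))"
      unfolding fourier_multiplier_def inverse_fourier_eq symbol riesz_symbol_eq_gaussian_mixture[OF p A]
      by (simp only: fourier_eq_cis H mult.assoc)
    also have "\<dots> = c * (LINT w|lborel. LINT \<xi>|lborel. H \<xi> w)"
      by (simp add: fubini)
    also have "(LINT w|lborel. LINT \<xi>|lborel. H \<xi> w) =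
        (LINT w|lborel. of_real (mix_density p w * (P (A * (1 + w)) x - P (1 + w) x)))"
    proof (rule Bochner_Integration.integral_cong[OF refl])
      fix w
      show "(LINT \<xi>|lborel. H \<xi> w) = of_real (mix_density p w * (P (A * (1 + w)) x - P (1 + w) x))"
      proof (cases "0 < w")
        case True
        have int: "integrable lborel (\<lambda>\<xi>. complex_of_real (gauss (1 / t) \<xi>) * cis (- (2 * pi * (\<xi> \<bullet> (- x)))))" if "0 < t" for t
          using that by (subst integrable_cis_iff) (auto simp: integrable_gauss)
        have F: "(LINT \<xi>|lborel. complex_of_real (gauss (1 / t) \<xi>) * cis (- (2 * pi * (\<xi> \<bullet> (- x))))) = of_real (P t x)" if "0 < t" for t
        proof -
          have "(LINT \<xi>|lborel. complex_of_real (gauss (1 / t) \<xi>) * cis (- (2 * pi * (\<xi> \<bullet> (- x))))) =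
            fourier (\<lambda>\<xi>. of_real (gauss (1 / t) \<xi>)) (- x)" by (simp add: fourier_eq_cis)
          also have "\<dots> = of_real ((1 / t) powr (real CARD('n) / 2) * gauss (1 / (1 / t)) (- x))"
            using that by (intro fourier_gauss) simp
          also have "\<dots> = of_real (P t x)"
            using that by (simp add: P_def gauss_def powr_minus powr_divide inverse_eq_divide)
          finally show ?thesis .
        qed
        have t: "0 < A * (1 + w)" "0 < 1 + w" using True A by auto
        have "(LINT \<xi>|lborel. H \<xi> w) = of_real (mix_density p w) *
          (LINT \<xi>|lborel. of_real (gauss (1 / (A * (1 + w))) \<xi>) * cis (- (2 * pi * (\<xi> \<bullet> (- x)))) -
             of_real (gauss (1 / (1 + w)) \<xi>) * cis (- (2 * pi * (\<xi> \<bullet> (- x)))))"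
          unfolding H_def integral_mult_right_zero[symmetric] by (simp add: algebra_simps)
        then show ?thesis
          unfolding Bochner_Integration.integral_diff[OF int[OF t(1)] int[OF t(2)]] F[OF t(1)] F[OF t(2)] by simp
      qed (simp add: H_def mix_density_def)
    qed
    finally have "ennreal (norm (fourier_multiplier m u x)) = ennreal (norm c) *
        ennreal (norm (LINT w|lborel. complex_of_real (mix_density p w * (P (A * (1 + w)) x - P (1 + w) x))))"
      by (simp add: norm_mult ennreal_mult)
    also have "\<dots> \<le> ennreal (norm c) * (\<integral>\<^sup>+w. norm (complex_of_real (mix_density p w * (P (A * (1 + w)) x - P (1 + w) x))) \<partial>lborel)"
      by (intro mult_left_mono ennreal_norm_integral_le) auto
    also have "\<dots> \<le> ennreal (norm c) * (\<integral>\<^sup>+w. ennreal (mix_density p w * (P (A * (1 + w)) x + P (1 + w) x)) \<partial>lborel)"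
    proof (intro mult_left_mono nn_integral_mono ennreal_leI)
      fix w
      have "\<bar>P (A * (1 + w)) x - P (1 + w) x\<bar> \<le> P (A * (1 + w)) x + P (1 + w) x"
        using P_nn[of "A * (1 + w)" x] P_nn[of "1 + w" x] by linarith
      from mult_left_mono[OF this mix_density_nonneg[OF p(2), of w]]
      show "norm (complex_of_real (mix_density p w * (P (A * (1 + w)) x - P (1 + w) x))) \<le>
          mix_density p w * (P (A * (1 + w)) x + P (1 + w) x)"
        unfolding norm_of_real abs_mult by (simp add: mix_density_nonneg[OF p(2)])
    qed auto
    finally show ?thesis .
  qed
  have "L1_norm (fourier_multiplier m u) \<le>
    (\<integral>\<^sup>+x. ennreal (norm c) * (\<integral>\<^sup>+w. ennreal (mix_density p w * (P (A * (1 + w)) x + P (1 + w) x)) \<partial>lborel) \<partial>lborel)"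
    unfolding L1_norm_def by (intro nn_integral_mono f_le)
  also have "\<dots> = ennreal (norm c) * (\<integral>\<^sup>+x. (\<integral>\<^sup>+w. ennreal (mix_density p w * (P (A * (1 + w)) x + P (1 + w) x)) \<partial>lborel) \<partial>lborel)"
    by (rule nn_integral_cmult) measurable
  also have "(\<integral>\<^sup>+x. (\<integral>\<^sup>+w. ennreal (mix_density p w * (P (A * (1 + w)) x + P (1 + w) x)) \<partial>lborel) \<partial>lborel) =
      (\<integral>\<^sup>+w. (\<integral>\<^sup>+x. ennreal (mix_density p w * (P (A * (1 + w)) x + P (1 + w) x)) \<partial>lborel) \<partial>lborel)"
    by (rule lborel_pair.Fubini'[symmetric]) measurable
  also have "\<dots> = (\<integral>\<^sup>+w. ennreal (2 * mix_density p w) \<partial>lborel)"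
  proof (rule nn_integral_cong)
    fix w
    show "(\<integral>\<^sup>+x. ennreal (mix_density p w * (P (A * (1 + w)) x + P (1 + w) x)) \<partial>lborel) = ennreal (2 * mix_density p w)"
    proof (cases "0 < w")
      case True
      then have t: "0 < A * (1 + w)" "0 < 1 + w" using A by auto
      have "(\<integral>\<^sup>+x. ennreal (mix_density p w * (P (A * (1 + w)) x + P (1 + w) x)) \<partial>lborel) =
        (\<integral>\<^sup>+x. ennreal (mix_density p w) * (ennreal (P (A * (1 + w)) x) + ennreal (P (1 + w) x)) \<partial>lborel)"
        by (intro nn_integral_cong) (simp add: ennreal_mult mix_density_nonneg[OF p(2)] P_nn)
      also have "\<dots> = ennreal (mix_density p w) * ((\<integral>\<^sup>+x. ennreal (P (A * (1 + w)) x) \<partial>lborel) + (\<integral>\<^sup>+x. ennreal (P (1 + w) x) \<partial>lborel))"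
        by (simp add: nn_integral_cmult nn_integral_add)
      also have "\<dots> = ennreal (mix_density p w) * (1 + 1)"
        unfolding P_def nn_integral_gauss_kernel[OF t(1)] nn_integral_gauss_kernel[OF t(2)] ..
      also have "\<dots> = ennreal (2 * mix_density p w)"
        using mix_density_nonneg[OF p(2), of w] by (simp add: ennreal_mult mult.commute)
      finally show ?thesis .
    qed (simp add: mix_density_def)
  qed
  also have "\<dots> = ennreal (2 * (LINT w|lborel. mix_density p w))"
    using integrable_mix_density[OF p] mix_density_nonneg[OF p(2)]
    by (subst nn_integral_eq_integral) auto
  also have "ennreal (norm c) * \<dots> = ennreal (norm c * (2 * (LINT w|lborel. mix_density p w)))"
    by (simp add: ennreal_mult')
  finally show ?thesis .
qed

section \<open>The capacitary inequalities\<close>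

text \<open>Here \<sigma> is 1 or -1, so that one argument serves both kinds of level sets;
  homogeneity turns the competitor \<open>(\<sigma> / t) * u\<close> into the factor
  \<open>1 / t\<close>.\<close>

lemma cap_open_superlevel_le:
  fixes X :: "(real^'n::finite \<Rightarrow> real) \<Rightarrow> ennreal"
  assumes hom: "\<And>c. X (\<lambda>x. c * u x) = ennreal \<bar>c\<bar> * X u"
    and u: "u \<in> schwartz" and t: "0 < t" and \<sigma>: "\<bar>\<sigma>\<bar> = 1"
  shows "ennreal t * cap_open X {x. t < \<sigma> * u x} \<le> X u"
proof -
  have "cap_open X {x. t < \<sigma> * u x} \<le> ennreal (1 / t) * X u"
    unfolding cap_open_def
  proof (rule SUP_least)
    fix K assume K: "K \<in> {K. compact K \<and> K \<subseteq> {x. t < \<sigma> * u x}}"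
    have "cap_compact X K \<le> X (\<lambda>x. (\<sigma> / t) * u x)"
      unfolding cap_compact_def using K t
      by (intro INF_lower CollectI conjI schwartz_cmult[OF u] ballI) (auto simp: pos_le_divide_eq less_imp_le)
    also have "\<dots> = ennreal (1 / t) * X u" using t \<sigma> by (simp only: hom) (simp add: abs_divide)
    finally show "cap_compact X K \<le> ennreal (1 / t) * X u" .
  qed
  then have "ennreal t * cap_open X {x. t < \<sigma> * u x} \<le> ennreal t * (ennreal (1 / t) * X u)"
    by (intro mult_left_mono) auto
  also have "\<dots> = X u" using t by (simp add: mult.assoc[symmetric] ennreal_mult[symmetric])
  finally show ?thesis .
qed

lemma borel_measurable_fourier_multiplier:
  fixes u :: "real^'n::finite \<Rightarrow> real"
  assumes u: "u \<in> schwartz" and [measurable]: "m \<in> borel_measurable borel"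
  shows "fourier_multiplier m u \<in> borel_measurable borel"
proof -
  have [measurable]: "u \<in> borel_measurable borel" by (rule borel_measurable_schwartz[OF u])
  show ?thesis
    unfolding fourier_multiplier_def[abs_def] inverse_fourier_eq by measurable
qed

lemma L1_norm_fourier_multiplier_cmult:
  fixes u :: "real^'n::finite \<Rightarrow> real"
  assumes u: "u \<in> schwartz" and m: "m \<in> borel_measurable borel"
  shows "L1_norm (fourier_multiplier m (\<lambda>x. c * u x)) = ennreal \<bar>c\<bar> * L1_norm (fourier_multiplier m u)"
proof -
  have "fourier (\<lambda>x. of_real (c * u x)) \<xi> = of_real c * fourier (\<lambda>x. of_real (u x)) \<xi>" for \<xi>
    unfolding fourier_def of_real_mult mult.assoc by (rule integral_mult_right_zero)
  then have "fourier_multiplier m (\<lambda>x. c * u x) x = of_real c * fourier_multiplier m u x" for x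
    unfolding fourier_multiplier_def inverse_fourier_def
    by (subst integral_mult_right_zero[symmetric]) (simp add: mult_ac)
  then show ?thesis
    using borel_measurable_fourier_multiplier[OF u m]
    by (simp add: L1_norm_def norm_mult ennreal_mult nn_integral_cmult)
qed

text \<open>If \<open>u\<close> exceeds \<open>c * r powr (- d)\<close> on a cube of size comparable to \<open>r\<close>, for all \<open>r\<close> between
  \<open>sqrt A\<close> and a constant, then the capacity of \<open>\<bar>u\<bar> > t\<close> is at least a multiple of \<open>1 / t\<close> on a range of \<open>t\<close> whose
  logarithmic length grows like \<open>ln (1 / A)\<close>.\<close>

lemma no_capacitary_strong_type:
  fixes X :: "(real^'n::finite \<Rightarrow> real) \<Rightarrow> ennreal"
  assumes K: "0 < K" and d: "0 < d" and \<rho>: "0 < \<rho>" and c: "0 < c"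
    and cube: "\<And>r x0 v. 0 < r \<Longrightarrow> v \<in> schwartz \<Longrightarrow> (\<And>x. (\<forall>i. \<bar>x $ i - x0 $ i\<bar> \<le> r) \<Longrightarrow> 1 \<le> v x) \<Longrightarrow>
      ennreal (r powr d) \<le> ennreal K * X v"
    and family: "\<And>A. 0 < A \<Longrightarrow> A < 1 \<Longrightarrow> \<exists>u\<in>schwartz. X u \<le> ennreal M \<and>
      (\<forall>r>0. A \<le> r\<^sup>2 \<longrightarrow> 2 * r\<^sup>2 \<le> 1 \<longrightarrow>
        (\<exists>x0. \<forall>x. (\<forall>i. \<bar>x $ i - x0 $ i\<bar> \<le> \<rho> * r) \<longrightarrow> c * r powr (- d) < \<bar>u x\<bar>))"
  shows "\<not> (\<exists>C::real. C > 0 \<and> (\<forall>u \<in> schwartz.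
    (\<integral>\<^sup>+t\<in>{0<..}. cap_open X {x. \<bar>u x\<bar> > t} \<partial>lborel) \<le> ennreal C * X u))"
proof
  assume "\<exists>C::real. C > 0 \<and> (\<forall>u \<in> schwartz.
    (\<integral>\<^sup>+t\<in>{0<..}. cap_open X {x. \<bar>u x\<bar> > t} \<partial>lborel) \<le> ennreal C * X u)"
  then obtain C where C: "0 < C"
    and strong: "\<And>u. u \<in> schwartz \<Longrightarrow> (\<integral>\<^sup>+t\<in>{0<..}. cap_open X {x. \<bar>u x\<bar> > t} \<partial>lborel) \<le> ennreal C * X u"
    by blast
  \<comment> \<open>\<open>ennreal\<close> truncates a negative \<open>M\<close> to 0; the real
    arithmetic below has to agree with that.\<close>
  define M' where "M' = max M 0"
  \<comment> \<open>At level \<open>t\<close> the cube has half-side \<open>\<rho> * r\<close> with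
    \<open>r powr d = c / t\<close>, so its capacity is at least
    \<open>(\<rho> * r) powr d / K = L / t\<close>.\<close>
  define L where "L = \<rho> powr d * c / K"
  have L: "0 < L" using \<rho> c K by (simp add: L_def)
  \<comment> \<open>Solves \<open>L * (ln t1 - ln t0) = C * M' + 1\<close>, one more than the
    assumed inequality allows; the term \<open>ln 2\<close> makes up for the condition
    \<open>2 * r\<^sup>2 \<le> 1\<close>.\<close>
  define A where "A = exp (- (2 * (C * M' + 1) / (L * d)) - ln 2)"
  have A: "0 < A" "A \<le> 1 / 2"
  proof -
    have "0 \<le> 2 * (C * M' + 1) / (L * d)" using C L d by (simp add: M'_def)
    then have "A \<le> exp (- ln 2)" unfolding A_def by (subst exp_le_cancel_iff) linarith
    then show "A \<le> 1 / 2" by (simp add: exp_minus)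
  qed (simp add: A_def)
  obtain u where u: "u \<in> schwartz" and Xu: "X u \<le> ennreal M" and
    large: "\<And>r. 0 < r \<Longrightarrow> A \<le> r\<^sup>2 \<Longrightarrow> 2 * r\<^sup>2 \<le> 1 \<Longrightarrow>
      \<exists>x0. \<forall>x. (\<forall>i. \<bar>x $ i - x0 $ i\<bar> \<le> \<rho> * r) \<longrightarrow> c * r powr (- d) < \<bar>u x\<bar>"
    using family[of A] A by auto
  \<comment> \<open>The levels \<open>c * r powr (- d)\<close> at the two ends of the range of r,
    \<open>r\<^sup>2 = 1 / 2\<close> for \<open>t0\<close> and \<open>r\<^sup>2 = A\<close> for
    \<open>t1\<close>.\<close>
  define t0 where "t0 = c * 2 powr (d / 2)"
  define t1 where "t1 = c * A powr (- (d / 2))"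
  have t0: "0 < t0" using c by (simp add: t0_def)
  have t01: "t0 \<le> t1"
  proof -
    have "2 powr (d / 2) = (1 / 2) powr (- (d / 2))" by (simp add: powr_minus powr_divide)
    also have "\<dots> \<le> A powr (- (d / 2))" using A d by (intro powr_mono2') auto
    finally show ?thesis using c by (simp add: t0_def t1_def)
  qed
  have cap: "ennreal (L / t) \<le> cap_open X {x. t < \<bar>u x\<bar>}" if t: "t0 \<le> t" "t \<le> t1" for t
  proof -
    have tpos: "0 < t" using t t0 by linarith
    define r where "r = (c / t) powr (1 / d)"
    have r: "0 < r" using c tpos by (simp add: r_def)
    have rd: "r powr d = c / t" using c tpos d by (simp add: r_def powr_powr)
    have r2: "r\<^sup>2 = (c / t) powr (2 / d)"
    proof -
      have "r\<^sup>2 = r powr 2" using r by simp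
      then show ?thesis by (simp add: r_def powr_powr)
    qed
    have "A powr (d / 2) \<le> c / t"
      using t(2) tpos A by (simp add: t1_def powr_minus field_simps)
    then have "(A powr (d / 2)) powr (2 / d) \<le> r\<^sup>2"
      unfolding r2 using d by (intro powr_mono2) auto
    then have Ar: "A \<le> r\<^sup>2" using A d by (simp add: powr_powr)
    have "c / t \<le> (1 / 2) powr (d / 2)"
      using t(1) tpos by (simp add: t0_def powr_divide field_simps)
    then have "r\<^sup>2 \<le> ((1 / 2) powr (d / 2)) powr (2 / d)"
      unfolding r2 using d c tpos by (intro powr_mono2) auto
    then have r2': "2 * r\<^sup>2 \<le> 1" using d by (simp add: powr_powr)
    obtain x0 where x0: "\<And>x. (\<forall>i. \<bar>x $ i - x0 $ i\<bar> \<le> \<rho> * r) \<Longrightarrow> c * r powr (- d) < \<bar>u x\<bar>"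
      using large[OF r Ar r2'] by blast
    have crd: "c * r powr (- d) = t" using rd c tpos by (simp add: powr_minus)
    define Q where "Q = cbox (x0 - (\<chi> i. \<rho> * r)) (x0 + (\<chi> i. \<rho> * r))"
    have Q: "x \<in> Q \<longleftrightarrow> (\<forall>i. \<bar>x $ i - x0 $ i\<bar> \<le> \<rho> * r)" for x
      unfolding Q_def by (auto simp: mem_box_cart abs_le_iff algebra_simps)
    have "ennreal (L / t) \<le> cap_compact X Q"
      unfolding cap_compact_def
    proof (rule INF_greatest)
      fix v assume v: "v \<in> {u \<in> schwartz. \<forall>x\<in>Q. 1 \<le> u x}"
      have "ennreal ((\<rho> * r) powr d) \<le> ennreal K * X v"
        using v \<rho> r by (intro cube[of "\<rho> * r" v x0]) (auto simp: Q)
      then have "ennreal (1 / K) * ennreal ((\<rho> * r) powr d) \<le> ennreal (1 / K) * (ennreal K * X v)"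
        by (intro mult_left_mono) auto
      also have "\<dots> = X v" using K by (simp add: mult.assoc[symmetric] ennreal_mult[symmetric])
      also have "ennreal (1 / K) * ennreal ((\<rho> * r) powr d) = ennreal (L / t)"
      proof -
        have "1 / K * (\<rho> * r) powr d = L / t" using K \<rho> r rd by (simp add: powr_mult L_def)
        then show ?thesis using K by (simp only: ennreal_mult'[symmetric] divide_nonneg_pos zero_le_one powr_ge_zero)
      qed
      finally show "ennreal (L / t) \<le> X v" .
    qed
    also have "\<dots> \<le> cap_open X {x. t < \<bar>u x\<bar>}"
      unfolding cap_open_def using x0 by (intro SUP_upper) (auto simp: Q crd, simp add: Q_def)
    finally show ?thesis .
  qed
  have "ennreal (C * M' + 1) = ennreal (L * ln t1 - L * ln t0)"
  proof -
    have "ln t1 - ln t0 = d / 2 * (- ln A - ln 2)"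
      using c A by (simp add: t0_def t1_def ln_mult ln_powr algebra_simps)
    also have "\<dots> = (C * M' + 1) / L" using L d by (simp add: A_def field_simps)
    finally show ?thesis using L by (simp add: right_diff_distrib[symmetric])
  qed
  also have "\<dots> = (\<integral>\<^sup>+t. ennreal (L / t) * indicator {t0..t1} t \<partial>lborel)"
    using t0 t01 L by (intro nn_integral_FTC_Icc[symmetric]) (auto intro!: derivative_eq_intros)
  also have "\<dots> \<le> (\<integral>\<^sup>+t\<in>{0<..}. cap_open X {x. \<bar>u x\<bar> > t} \<partial>lborel)"
    using cap t0 by (intro nn_integral_mono) (auto simp: indicator_def)
  also have "\<dots> \<le> ennreal C * X u" by (rule strong[OF u])
  also have "\<dots> \<le> ennreal C * ennreal M'"
    using Xu by (intro mult_left_mono) (auto simp: M'_def intro: order_trans ennreal_leI)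
  also have "\<dots> = ennreal (C * M')" using C by (simp add: ennreal_mult M'_def)
  finally show False using C by (simp add: M'_def)
qed

section \<open>The counterexamples for the two fractional gradients\<close>

lemma continuous_on_riesz_symbol:
  fixes s :: real
  assumes "0 < s"
  shows "continuous_on UNIV (\<lambda>\<xi>::real^'n::finite. (2 * pi * norm \<xi>) powr s)"
  using assms by (intro continuous_on_powr' continuous_intros) auto

lemma no_capacitary_strong_type_H_plus:
  assumes s: "0 < s" "s < 1"
  shows "\<not> (\<exists>C::real. C > 0 \<and> (\<forall>u \<in> (schwartz :: (real^'n::finite \<Rightarrow> real) set).
    (\<integral>\<^sup>+t\<in>{0<..}. cap_open (H_plus s) {x. \<bar>u x\<bar> > t} \<partial>lborel) \<le> ennreal C * H_plus s u))"
proof -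
  let ?n = "real CARD('n)"
  have n: "1 \<le> ?n" by (simp add: Suc_leI)
  define m where "m \<xi> = complex_of_real ((2 * pi * norm \<xi>) powr s)" for \<xi> :: "real^'n"
  have H: "H_plus s u = L1_norm (fourier_multiplier m u)" for u :: "real^'n \<Rightarrow> real"
    by (simp add: H_plus_def nabla_plus_def m_def[abs_def])
  have m: "continuous_on UNIV m"
    unfolding m_def by (intro continuous_on_of_real continuous_on_riesz_symbol s)
  obtain K where K: "0 < K" and cube: "\<And>r x0 v. 0 < r \<Longrightarrow> v \<in> schwartz \<Longrightarrow> (\<And>x::real^'n. (\<forall>i. \<bar>x $ i - x0 $ i\<bar> \<le> r) \<Longrightarrow> 1 \<le> v x) \<Longrightarrow>
      ennreal (r powr (?n - s)) \<le> ennreal K * H_plus s v"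
    using multiplier_norm_lower_bound[OF m s] unfolding H by (auto simp: m_def)
  \<comment> \<open>The lower bound for the mixture has degree \<open>2 * b + 2\<close>, which must
    be s - n as for the Riesz kernel. The transform adds n/2 to the exponent, which gives p - 1 with
    p = s/2, so the symbol supplies exactly the factor
    \<open>norm \<xi> powr (2 * p)\<close>.\<close>
  define b where "b = (s - ?n) / 2 - 1"
  have b: "b + ?n / 2 = s / 2 - 1" "2 * b + 2 = - (?n - s)" "b \<le> 0" using n s by (auto simp: b_def field_simps)
  define M where "M = norm (complex_of_real ((2 * pi) powr s)) * (2 * (LINT w|lborel. mix_density (s / 2) w))"
  \<comment> \<open>A cube of half-side r/n lies in the ball of radius r because the norm is at most
    the sum of the coordinates; halving the constant makes the lower bound strict.\<close>
  show ?thesis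
  proof (rule no_capacitary_strong_type[OF K _ _ _ cube, where \<rho> = "1 / ?n" and c = "exp (- pi) * 2 powr b / 2" and M = M])
    show "0 < ?n - s" using n s by linarith
    fix A :: real assume A: "0 < A" "A < 1"
    have A': "A \<le> 1" using A by simp
    have "H_plus s (gauss_mix A b :: real^'n \<Rightarrow> real) \<le> ennreal M"
      unfolding H M_def
    proof (rule multiplier_norm_upper_bound[OF _ _ A(1) A'])
      fix \<xi> :: "real^'n"
      show "m \<xi> * fourier (\<lambda>x. of_real (gauss_mix A b x)) \<xi> = of_real ((2 * pi) powr s) *
        of_real (norm \<xi> powr (2 * (s / 2)) * (LINT \<tau>|lborel. indicator {A..1} \<tau> * (\<tau> powr (s / 2 - 1) * gauss (1 / \<tau>) \<xi>)))"
        unfolding fourier_gauss_mix[OF A(1) A'] b(1) m_def by (simp add: powr_mult)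
    qed (use s in auto)
    moreover have "exp (- pi) * 2 powr b / 2 * r powr (- (?n - s)) < \<bar>gauss_mix A b x\<bar>"
      if r: "0 < r" "A \<le> r\<^sup>2" "2 * r\<^sup>2 \<le> 1" and x: "\<forall>i. \<bar>x $ i - (0::real^'n) $ i\<bar> \<le> 1 / ?n * r" for r x
    proof -
      have "norm x \<le> (\<Sum>i\<in>UNIV. \<bar>x $ i\<bar>)" by (rule norm_le_l1_cart)
      also have "\<dots> \<le> ?n * (1 / ?n * r)" using x by (intro sum_bounded_above) auto
      finally have "norm x \<le> r" by simp
      from gauss_mix_lower_bound[OF A(1) A' r(2,3,1) b(3) this]
      have "exp (- pi) * 2 powr b * r powr (- (?n - s)) \<le> gauss_mix A b x" unfolding b(2) .
      moreover have "0 < exp (- pi) * 2 powr b * r powr (- (?n - s))" using r by simp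
      moreover have "exp (- pi) * 2 powr b / 2 * r powr (- (?n - s)) = (exp (- pi) * 2 powr b * r powr (- (?n - s))) / 2" by simp
      ultimately show ?thesis by argo
    qed
    ultimately show "\<exists>u\<in>schwartz. H_plus s u \<le> ennreal M \<and>
      (\<forall>r>0. A \<le> r\<^sup>2 \<longrightarrow> 2 * r\<^sup>2 \<le> 1 \<longrightarrow>
        (\<exists>x0::real^'n. \<forall>x. (\<forall>i. \<bar>x $ i - x0 $ i\<bar> \<le> 1 / ?n * r) \<longrightarrow> exp (- pi) * 2 powr b / 2 * r powr (- (?n - s)) < \<bar>u x\<bar>))"
      by (intro bexI[OF _ schwartz_gauss_mix[OF A(1) A', of b]] conjI allI impI exI[of _ 0])
  qed simp_all
qed

text \<open>An odd symbol calls for an odd test function: for a derivative of a mixture the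
  transform carries the factor \<xi>, and together with the symbol it becomes an even power, so
  \<open>multiplier_norm_upper_bound\<close> applies again.\<close>

lemma no_capacitary_strong_type_H_minus:
  assumes s: "0 < s" "s < 1" and card: "CARD('n) = 1"
  shows "\<not> (\<exists>C::real. C > 0 \<and> (\<forall>u \<in> (schwartz :: (real^'n::finite \<Rightarrow> real) set).
    (\<integral>\<^sup>+t\<in>{0<..}. cap_open (H_minus s) {x. \<bar>u x\<bar> > t} \<partial>lborel) \<le> ennreal C * H_minus s u))"
proof -
  obtain j :: 'n where j: "UNIV = {j}" using card by (rule card_1_singletonE)
  have norm_j: "norm x = \<bar>x $ j\<bar>" for x :: "real^'n"
    unfolding norm_vec_def L2_set_def j by simp
  define m where "m \<xi> = - (2 * of_real pi * \<i> * of_real (\<xi> $ j)) * complex_of_real ((2 * pi * norm \<xi>) powr (s - 1))" for \<xi> :: "real^'n"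
  have H: "H_minus s u = L1_norm (fourier_multiplier m u)" for u :: "real^'n \<Rightarrow> real"
    by (simp add: H_minus_def nabla_minus_def m_def[abs_def] j)
  have norm_m: "norm (m \<xi>) = (2 * pi * norm \<xi>) powr s" for \<xi>
  proof (cases "\<xi> = 0")
    case False
    then have "norm (m \<xi>) = (2 * pi * norm \<xi>) powr 1 * (2 * pi * norm \<xi>) powr (s - 1)"
      by (simp add: m_def norm_mult norm_j)
    also have "\<dots> = (2 * pi * norm \<xi>) powr s" unfolding powr_add[symmetric] by simp
    finally show ?thesis .
  qed (simp add: m_def)
  \<comment> \<open>At the origin the factor with exponent \<open>s - 1\<close> is not continuous;
    there continuity follows from the modulus tending to 0.\<close>
  have m: "continuous_on UNIV m"
  proof (intro continuous_at_imp_continuous_on ballI)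
    fix \<xi> :: "real^'n"
    show "isCont m \<xi>"
    proof (cases "\<xi> = 0")
      case True
      have "isCont (\<lambda>\<xi>::real^'n. (2 * pi * norm \<xi>) powr s) 0"
        using continuous_on_riesz_symbol[OF s(1)] by (auto simp: continuous_on_eq_continuous_at)
      then have "((\<lambda>\<xi>::real^'n. norm (m \<xi>)) \<longlongrightarrow> 0) (at 0)"
        by (simp add: isCont_def norm_m)
      then have "(m \<longlongrightarrow> 0) (at 0)" by (rule tendsto_norm_zero_cancel)
      moreover have "m 0 = 0" by (simp add: m_def)
      ultimately show ?thesis by (simp add: True isCont_def)
    next
      case False
      then show ?thesis unfolding m_def by (intro continuous_intros) auto
    qed
  qed
  obtain K where K: "0 < K" and cube: "\<And>r x0 v. 0 < r \<Longrightarrow> v \<in> schwartz \<Longrightarrow> (\<And>x::real^'n. (\<forall>i. \<bar>x $ i - x0 $ i\<bar> \<le> r) \<Longrightarrow> 1 \<le> v x) \<Longrightarrow>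
      ennreal (r powr (1 - s)) \<le> ennreal K * H_minus s v"
    using multiplier_norm_lower_bound[OF m s norm_m] card unfolding H by auto
  \<comment> \<open>Differentiation lowers \<open>b\<close> by one, so \<open>u\<close> is
    \<open>x $ j\<close> times a mixture of degree \<open>2 * (b - 1) + 2 = s - 2\<close>. On the
    Fourier side \<open>b + 1 / 2 = p - 1\<close>.\<close>
  define b where "b = s / 2 - 1"
  define p where "p = (s + 1) / 2"
  \<comment> \<open>The odd function vanishes at 0, so the interval is centred at 3r/4 with
    half-side r/4. There \<open>x $ j\<close> is at least r/2, which costs one factor 2; the other
    makes the inequality strict.\<close>
  define c where "c = exp (- pi) * 2 powr (b - 1) / 4"
  define M where "M = norm (- complex_of_real ((2 * pi) powr s)) * (2 * (LINT w|lborel. mix_density p w))"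
  show ?thesis
  proof (rule no_capacitary_strong_type[OF K _ _ _ cube, where \<rho> = "1 / 4" and c = c and M = M])
    fix A :: real assume A: "0 < A" "A < 1"
    have A': "A \<le> 1" using A by simp
    define u where "u x = - (1 / (2 * pi)) * partial j (gauss_mix A b) x" for x :: "real^'n"
    have u: "u \<in> schwartz"
      unfolding u_def by (intro schwartz_cmult schwartz_partial schwartz_gauss_mix A A')
    have u_eq: "u x = x $ j * gauss_mix A (b - 1) x" for x
      by (simp add: u_def partial_gauss_mix[OF A(1) A'])
    have "H_minus s u \<le> ennreal M"
      unfolding H M_def
    proof (rule multiplier_norm_upper_bound[OF _ _ A(1) A'])
      fix \<xi> :: "real^'n"
      define S where "S = (LINT \<tau>|lborel. indicator {A..1} \<tau> * (\<tau> powr (p - 1) * gauss (1 / \<tau>) \<xi>))"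
      have F_mix: "fourier (\<lambda>x. of_real (gauss_mix A b x)) \<xi> = of_real S"
      proof -
        have "b + real CARD('n) / 2 = p - 1" using card by (simp add: b_def p_def field_simps)
        then show ?thesis unfolding fourier_gauss_mix[OF A(1) A'] S_def by simp
      qed
      have "fourier (\<lambda>x. of_real (u x)) \<xi> = of_real (- (1 / (2 * pi))) * fourier (\<lambda>x. of_real (partial j (gauss_mix A b) x)) \<xi>"
        unfolding u_def fourier_def of_real_mult mult.assoc by (rule integral_mult_right_zero)
      also have "\<dots> = - \<i> * of_real (\<xi> $ j) * of_real S"
        unfolding fourier_partial[OF schwartz_gauss_mix[OF A(1) A']] F_mix by simp
      finally have Fu: "fourier (\<lambda>x. of_real (u x)) \<xi> = - \<i> * of_real (\<xi> $ j) * of_real S" .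
      \<comment> \<open>One factor \<xi> comes from the symbol and one from the derivative. In one
        dimension their product is the squared norm, and 2 + (s - 1) is
        \<open>2 * p\<close>.\<close>
      have "(\<xi> $ j)\<^sup>2 * (2 * pi) * (2 * pi * norm \<xi>) powr (s - 1) = (2 * pi) powr s * norm \<xi> powr (2 * p)"
      proof (cases "\<xi> = 0")
        case False
        have "2 * p = 2 + (s - 1)" by (simp add: p_def field_simps)
        then have "norm \<xi> powr (2 * p) = norm \<xi> powr (2 + (s - 1))" by (rule arg_cong)
        also have "\<dots> = (norm \<xi>)\<^sup>2 * norm \<xi> powr (s - 1)" using False by (subst powr_add) simp
        finally have "norm \<xi> powr (2 * p) = (\<xi> $ j)\<^sup>2 * norm \<xi> powr (s - 1)" by (simp add: norm_j)
        moreover have "(2 * pi) powr s = (2 * pi) * (2 * pi) powr (s - 1)" by (simp add: powr_diff)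
        ultimately show ?thesis by (simp add: powr_mult)
      qed simp
      then have eq: "complex_of_real ((\<xi> $ j)\<^sup>2 * (2 * pi) * (2 * pi * norm \<xi>) powr (s - 1)) = of_real ((2 * pi) powr s * norm \<xi> powr (2 * p))"
        by (rule arg_cong)
      have "m \<xi> * fourier (\<lambda>x. of_real (u x)) \<xi> = - (complex_of_real ((\<xi> $ j)\<^sup>2 * (2 * pi) * (2 * pi * norm \<xi>) powr (s - 1)) * of_real S)"
        unfolding m_def Fu by (simp add: power2_eq_square algebra_simps)
      then show "m \<xi> * fourier (\<lambda>x. of_real (u x)) \<xi> = - of_real ((2 * pi) powr s) *
          of_real (norm \<xi> powr (2 * p) * (LINT \<tau>|lborel. indicator {A..1} \<tau> * (\<tau> powr (p - 1) * gauss (1 / \<tau>) \<xi>)))"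
        unfolding eq S_def[symmetric] by simp
    qed (use s in \<open>auto simp: p_def\<close>)
    moreover have "\<exists>x0::real^'n. \<forall>x. (\<forall>i. \<bar>x $ i - x0 $ i\<bar> \<le> 1 / 4 * r) \<longrightarrow> c * r powr (- (1 - s)) < \<bar>u x\<bar>"
      if r: "0 < r" "A \<le> r\<^sup>2" "2 * r\<^sup>2 \<le> 1" for r
    proof (intro exI[of _ "\<chi> i. 3 / 4 * r"] allI impI)
      fix x :: "real^'n" assume "\<forall>i. \<bar>x $ i - (\<chi> i. 3 / 4 * r) $ i\<bar> \<le> 1 / 4 * r"
      then have "\<bar>x $ j - 3 / 4 * r\<bar> \<le> 1 / 4 * r" by simp
      then have x: "r / 2 \<le> x $ j" "norm x \<le> r" unfolding norm_j using r by linarith+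
      have "b - 1 \<le> 0" using s by (simp add: b_def)
      from gauss_mix_lower_bound[OF A(1) A' r(2,3,1) this x(2)]
      have low: "exp (- pi) * 2 powr (b - 1) * r powr (s - 2) \<le> gauss_mix A (b - 1) x" by (simp add: b_def)
      have rs: "r * r powr (s - 2) = r powr (- (1 - s))"
        using r powr_add[of r 1 "s - 2"] by simp
      have "c * r powr (- (1 - s)) < (2 * c) * r powr (- (1 - s))" using r by (simp add: c_def)
      also have "\<dots> = r / 2 * (exp (- pi) * 2 powr (b - 1) * r powr (s - 2))"
        unfolding rs[symmetric] by (simp add: c_def)
      also have "\<dots> \<le> x $ j * gauss_mix A (b - 1) x"
        using x r by (intro mult_mono low) auto
      finally show "c * r powr (- (1 - s)) < \<bar>u x\<bar>" unfolding u_eq by linarith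
    qed
    ultimately show "\<exists>u\<in>schwartz. H_minus s u \<le> ennreal M \<and>
      (\<forall>r>0. A \<le> r\<^sup>2 \<longrightarrow> 2 * r\<^sup>2 \<le> 1 \<longrightarrow>
        (\<exists>x0::real^'n. \<forall>x. (\<forall>i. \<bar>x $ i - x0 $ i\<bar> \<le> 1 / 4 * r) \<longrightarrow> c * r powr (- (1 - s)) < \<bar>u x\<bar>))"
      using u by blast
  qed (use s in \<open>simp_all add: c_def\<close>)
qed

lemma H_plus_cmult:
  fixes u :: "real^'n::finite \<Rightarrow> real"
  shows "u \<in> schwartz \<Longrightarrow> H_plus s (\<lambda>x. c * u x) = ennreal \<bar>c\<bar> * H_plus s u"
  unfolding H_plus_def nabla_plus_def by (rule L1_norm_fourier_multiplier_cmult) auto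

lemma H_minus_cmult:
  fixes u :: "real^'n::finite \<Rightarrow> real"
  shows "u \<in> schwartz \<Longrightarrow> H_minus s (\<lambda>x. c * u x) = ennreal \<bar>c\<bar> * H_minus s u"
  unfolding H_minus_def nabla_minus_def sum_distrib_left
  by (intro sum.cong refl L1_norm_fourier_multiplier_cmult) auto

theorem theorem3p6:
  fixes s :: real
  assumes "0 < s" and "s < 1"
  shows "(\<forall>X \<in> {H_plus s, H_minus s}. \<forall>u \<in> (schwartz :: (real^'n \<Rightarrow> real) set).
           X u \<ge> (SUP t \<in> {0<..}. ennreal t * cap_open X {x. u x > t}) \<and>
           X u \<ge> (SUP t \<in> {0<..}. ennreal t * cap_open X {x. u x < - t})) \<and>
         (\<forall>X :: (real^'n \<Rightarrow> real) \<Rightarrow> ennreal.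
           X = H_plus s \<or> (X = H_minus s \<and> CARD('n) = 1) \<longrightarrow>
           \<not> (\<exists>C::real. C > 0 \<and> (\<forall>u \<in> schwartz.
                (\<integral>\<^sup>+t\<in>{0<..}. cap_open X {x. \<bar>u x\<bar> > t} \<partial>lborel) \<le> ennreal C * X u)))"
proof (intro conjI ballI)
  fix X :: "(real^'n \<Rightarrow> real) \<Rightarrow> ennreal" and u :: "real^'n \<Rightarrow> real"
  assume X: "X \<in> {H_plus s, H_minus s}" and u: "u \<in> schwartz"
  have hom: "X (\<lambda>x. c * u x) = ennreal \<bar>c\<bar> * X u" for c
    using X u by (auto simp: H_plus_cmult H_minus_cmult)
  show "(SUP t \<in> {0<..}. ennreal t * cap_open X {x. u x > t}) \<le> X u"
    using cap_open_superlevel_le[OF hom u, of _ 1] by (intro SUP_least) simp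
  have "{x. u x < - t} = {x. t < - 1 * u x}" for t by auto
  then show "(SUP t \<in> {0<..}. ennreal t * cap_open X {x. u x < - t}) \<le> X u"
    using cap_open_superlevel_le[OF hom u, of _ "- 1"] by (intro SUP_least) simp
next
  show "\<forall>X :: (real^'n \<Rightarrow> real) \<Rightarrow> ennreal.
    X = H_plus s \<or> (X = H_minus s \<and> CARD('n) = 1) \<longrightarrow>
    \<not> (\<exists>C::real. C > 0 \<and> (\<forall>u \<in> schwartz.
      (\<integral>\<^sup>+t\<in>{0<..}. cap_open X {x. \<bar>u x\<bar> > t} \<partial>lborel) \<le> ennreal C * X u))"
    using no_capacitary_strong_type_H_plus[OF assms] no_capacitary_strong_type_H_minus[OF assms] by blast
qed

end
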